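(* Let $(X,\mu)$ be a non-atomic Lebesgue space with a positive finite or $\sigma$-finite measure. If an ergodic, nonsingular transformation $T:X\to X$ is measurably sensitive, then for some positive integer $n$, $T^n$ has $n$ invariant subsets of positive measure, distinct modulo null sets, and the restriction of $T^n$ to each of these subsets is weakly mixing.
   Context: $T$ is nonsingular if it is measurable and, for measurable $A$, $\mu(A)=0$ if and only if $\mu(T^{-1}(A))=0$. A measurable set $A$ is invariant under $S$ if $S^{-1}(A)=A$ modulo $\mu$. A nonsingular transformation is weakly mixing if it is ergodic and its only $L^\infty$ eigenvalue is $1$, where $\lambda$ is an ($L^\infty$) eigenvalue of $S$ if there is an a.e. nonzero $f\in L^\infty$ with $f\circ S=\lambda f$ a.e. A metric $d$ on a measure space is good if all nonempty open sets have positive measure; when a space carries a good metric, the measure on it is assumed to be regular (so open sets are measurable). $B_\varepsilon(x)$ denotes the open $d$-ball of radius $\varepsilon$ about $x$. Two systems $(X,\mu,T)$ and $(X_1,\mu_1,T_1)$ are measure-theoretically isomorphic if, after discarding null sets (with forward-invariant complements), there is a bimeasurable bijection between them that carries $\mu$ to $\mu_1$ and intertwines $T$ and $T_1$. $T$ is measurably sensitive if whenever $(X_1,\mu_1,T_1)$ is measure-theoretically isomorphic to $(X,\mu,T)$ and $d$ is a good metric on $X_1$, there exists $\delta>0$ such that for all $x\in X_1$ and all $\varepsilon>0$ there exists $N\in\mathbb{N}$ such that for all integers $n\ge N$, $\mu_1\{y\in B_\varepsilon(x): d(T_1^n(x),T_1^n(y))>\delta\}>0$. *)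

theory Defs
  imports "HOL-Analysis.Analysis"
begin

text \<open>\<open>mod_null_iso M Y M' Y' \<phi>\<close>: the sets \<open>Y\<close> and \<open>Y'\<close> have null complements in \<open>M\<close> and \<open>M'\<close>, and
  \<open>\<phi>\<close> is a bimeasurable, measure-preserving bijection between them.\<close>

definition mod_null_iso ::
  "'a measure \<Rightarrow> 'a set \<Rightarrow> 'b measure \<Rightarrow> 'b set \<Rightarrow> ('a \<Rightarrow> 'b) \<Rightarrow> bool" where
  "mod_null_iso M Y M' Y' \<phi> \<longleftrightarrow>
     Y \<in> sets M \<and> space M - Y \<in> null_sets M \<and>
     Y' \<in> sets M' \<and> space M' - Y' \<in> null_sets M' \<and>
     bij_betw \<phi> Y Y' \<and>
     \<phi> \<in> restrict_space M Y \<rightarrow>\<^sub>M restrict_space M' Y' \<and>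
     the_inv_into Y \<phi> \<in> restrict_space M' Y' \<rightarrow>\<^sub>M restrict_space M Y \<and>
     distr (restrict_space M Y) (restrict_space M' Y') \<phi> = restrict_space M' Y'"

text \<open>Lebesgue(-Rokhlin) spaces with a finite or \<open>\<sigma>\<close>-finite measure: complete measure spaces
  that are isomorphic, modulo null sets, to the completion of a standard Borel measure space.
  Every standard Borel space is Borel isomorphic to a Borel subset of the real line, so it is
  enough to use Borel measures on the reals as models.\<close>

definition lebesgue_space :: "'a measure \<Rightarrow> bool" where
  "lebesgue_space M \<longleftrightarrow>
     complete_measure M \<and> sigma_finite_measure M \<and>
     (\<exists>(N :: real measure) Y Y' \<phi>. sets N = sets borel \<and> sigma_finite_measure N \<and>
        mod_null_iso M Y (completion N) Y' \<phi>)"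

definition non_atomic :: "'a measure \<Rightarrow> bool" where
  "non_atomic M \<longleftrightarrow>
     (\<forall>A\<in>sets M. 0 < emeasure M A \<longrightarrow>
        (\<exists>B\<in>sets M. B \<subseteq> A \<and> 0 < emeasure M B \<and> emeasure M B < emeasure M A))"

definition nonsingular :: "'a measure \<Rightarrow> ('a \<Rightarrow> 'a) \<Rightarrow> bool" where
  "nonsingular M T \<longleftrightarrow>
     T \<in> M \<rightarrow>\<^sub>M M \<and>
     (\<forall>A\<in>sets M. emeasure M A = 0 \<longleftrightarrow> emeasure M (T -` A \<inter> space M) = 0)"

definition eq_mod_null :: "'a measure \<Rightarrow> 'a set \<Rightarrow> 'a set \<Rightarrow> bool" where
  "eq_mod_null M A B \<longleftrightarrow> sym_diff A B \<in> null_sets M"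

definition invariant_set :: "'a measure \<Rightarrow> ('a \<Rightarrow> 'a) \<Rightarrow> 'a set \<Rightarrow> bool" where
  "invariant_set M S A \<longleftrightarrow> A \<in> sets M \<and> eq_mod_null M (S -` A \<inter> space M) A"

definition ergodic :: "'a measure \<Rightarrow> ('a \<Rightarrow> 'a) \<Rightarrow> bool" where
  "ergodic M S \<longleftrightarrow>
     (\<forall>A. invariant_set M S A \<longrightarrow> emeasure M A = 0 \<or> emeasure M (space M - A) = 0)"

definition Linf_eigenvalue :: "'a measure \<Rightarrow> ('a \<Rightarrow> 'a) \<Rightarrow> complex \<Rightarrow> bool" where
  "Linf_eigenvalue M S c \<longleftrightarrow>
     (\<exists>f :: 'a \<Rightarrow> complex. f \<in> borel_measurable M \<and> (\<exists>C. AE x in M. cmod (f x) \<le> C) \<and>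
        (AE x in M. f x \<noteq> 0) \<and> (AE x in M. f (S x) = c * f x))"

text \<open>Through \<open>nonsingular\<close>, weak mixing of \<open>S\<close> on \<open>restrict_space M A\<close> includes
  that \<open>S\<close> maps \<open>A\<close> into itself.  For a set that is invariant modulo null sets, this only
  selects a representative: \<open>A\<close> equals its intersection with all \<open>S\<close>-preimages modulo null sets.\<close>

definition weakly_mixing :: "'a measure \<Rightarrow> ('a \<Rightarrow> 'a) \<Rightarrow> bool" where
  "weakly_mixing M S \<longleftrightarrow>
     nonsingular M S \<and> ergodic M S \<and> {c. Linf_eigenvalue M S c} = {1}"

text \<open>Regularity with respect to the topology of the metric: open sets are measurable, and
  measurable sets are approximated from outside by open and from inside by compact sets.\<close>

definition regular_wrt :: "'a measure \<Rightarrow> ('a \<Rightarrow> 'a \<Rightarrow> real) \<Rightarrow> bool" where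
  "regular_wrt M d \<longleftrightarrow>
     (let X = Metric_space.mtopology (space M) d in
       (\<forall>U. openin X U \<longrightarrow> U \<in> sets M) \<and>
       (\<forall>A\<in>sets M. emeasure M A = (INF U\<in>{U. openin X U \<and> A \<subseteq> U}. emeasure M U)) \<and>
       (\<forall>A\<in>sets M. emeasure M A = (SUP K\<in>{K. compactin X K \<and> K \<subseteq> A}. emeasure M K)))"

definition good_metric :: "'a measure \<Rightarrow> ('a \<Rightarrow> 'a \<Rightarrow> real) \<Rightarrow> bool" where
  "good_metric M d \<longleftrightarrow>
     Metric_space (space M) d \<and> regular_wrt M d \<and>
     (\<forall>U. openin (Metric_space.mtopology (space M) d) U \<and> U \<noteq> {} \<longrightarrow> 0 < emeasure M U)"

definition isomorphic_systems ::
  "'a measure \<Rightarrow> ('a \<Rightarrow> 'a) \<Rightarrow> 'b measure \<Rightarrow> ('b \<Rightarrow> 'b) \<Rightarrow> bool" where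
  "isomorphic_systems M T M' T' \<longleftrightarrow>
     (\<exists>Y Y' \<phi>. mod_null_iso M Y M' Y' \<phi> \<and> T ` Y \<subseteq> Y \<and> T' ` Y' \<subseteq> Y' \<and>
        (\<forall>x\<in>Y. \<phi> (T x) = T' (\<phi> x)))"

text \<open>HOL cannot quantify over the type carrying \<open>M\<^sub>1\<close>; taking it to be \<^typ>\<open>real\<close> is no
  restriction when \<open>M\<close> is a Lebesgue space.  Any space isomorphic to \<open>M\<close> has a
  subset of full measure of cardinality at most that of the continuum.  If the space carries a
  good metric, that subset meets every nonempty open set, so it is dense; as every point is the
  limit of a sequence from it, the whole space has at most continuum many points and can be
  relabelled by reals.\<close>

definition measurably_sensitive :: "'a measure \<Rightarrow> ('a \<Rightarrow> 'a) \<Rightarrow> bool" where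
  "measurably_sensitive M T \<longleftrightarrow>
     (\<forall>(M\<^sub>1 :: real measure) T\<^sub>1 d.
        nonsingular M\<^sub>1 T\<^sub>1 \<and> isomorphic_systems M T M\<^sub>1 T\<^sub>1 \<and> good_metric M\<^sub>1 d \<longrightarrow>
        (\<exists>\<delta>>0. \<forall>x\<in>space M\<^sub>1. \<forall>\<epsilon>>0. \<exists>N::nat. \<forall>n\<ge>N.
           0 < emeasure M\<^sub>1 {y \<in> Metric_space.mball (space M\<^sub>1) d x \<epsilon>.
                 d ((T\<^sub>1 ^^ n) x) ((T\<^sub>1 ^^ n) y) > \<delta>}))"

end

theory Submission
  imports Defs
begin

text \<open>Choosing the metric freely, one shows that a sensitive \<open>T\<close> admits no disjoint sequence \<open>A\<^sub>j\<close> with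
  sets \<open>P\<^sub>j \<subseteq> A\<^sub>j\<close> of positive measure that \<open>T\<^sup>n\<close> maps into \<open>A\<^sub>j\<close>, modulo null sets, for infinitely many \<open>n\<close>:
  take a metric for which the \<open>P\<^sub>j\<close> are open and the diameters of the \<open>A\<^sub>j\<close> tend to \<open>0\<close>.
  Applied to sets with \<open>T\<^sup>-\<^sup>m A = A\<close> for some \<open>m > 0\<close>, this shows that the algebra of these periodic
  sets has an atom \<open>A\<close>; if \<open>n\<close> is its least period, the sets \<open>T\<^sup>-\<^sup>i A\<close> for \<open>i < n\<close> are
  disjoint, and \<open>T\<^sup>n\<close> is ergodic on each of them.  An eigenfunction of \<open>T\<^sup>n\<close> on such an atom with an
  eigenvalue other than \<open>1\<close> would either split the atom into periodic sets or, through the recurrence of an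
  irrational rotation, give a sequence \<open>P\<^sub>j \<subseteq> A\<^sub>j\<close> as above.\<close>

subsection \<open>A metric with prescribed small open pieces\<close>

text \<open>Sensitivity speaks of every good metric on every isomorphic copy, so a metric may be
  designed against it. The obstacle is goodness: open sets must be measurable and non-null, and the
  measure regular. Therefore the system is moved to a subset of the real line, where Euclidean
  compact sets supply regularity, and points with null neighbourhoods are removed together with
  every point whose orbit reaches them. The constant \<delta> is known only once the metric is
  fixed. One recurrent set does not suffice; a single metric has to contain recurrent sets of
  arbitrarily small diameter, hence a sequence. The return times may differ from set to set and need
  no pattern, because sensitivity claims separation at all late times and one return refutes it. Two
  families are used because a set moved by a rotation close to the identity returns only to a
  slightly larger set; for periodic sets both families coincide.\<close>

text \<open>The pieces \<open>p = m\<close> are open, and the group \<open>k \<circ> p = j\<close> of pieces has diameter at most \<open>1 / (1 + j)\<close>.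
  If the pieces have finite measure, the measure is locally finite, which is what regularity needs.\<close>

definition piece_dist :: "(real \<Rightarrow> nat) \<Rightarrow> (nat \<Rightarrow> nat) \<Rightarrow> real \<Rightarrow> real \<Rightarrow> real" where
  "piece_dist p k x y =
     (if p x = p y then min 1 \<bar>x - y\<bar> / (1 + real (k (p x)))
      else if k (p x) = k (p y) then 1 / (1 + real (k (p x))) else 1)"

lemma piece_dist_le_group:
  "k (p x) = k (p y) \<Longrightarrow> piece_dist p k x y \<le> 1 / (1 + real (k (p x)))"
  by (auto simp: piece_dist_def divide_simps)

lemma piece_dist_le_one: "piece_dist p k x y \<le> 1"
  by (auto simp: piece_dist_def divide_simps)

lemma piece_dist_less_imp_same_piece:
  "piece_dist p k x y < 1 / (1 + real (k (p x))) \<Longrightarrow> p y = p x"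
  by (auto simp: piece_dist_def divide_simps split: if_splits)

lemma Metric_space_piece_dist: "Metric_space S (piece_dist p k)"
proof
  show "0 \<le> piece_dist p k x y" for x y
    by (simp add: piece_dist_def)
  show sym: "piece_dist p k x y = piece_dist p k y x" for x y
    by (simp add: piece_dist_def abs_minus_commute)
  show "piece_dist p k x y = 0 \<longleftrightarrow> x = y" for x y
    by (auto simp: piece_dist_def min_def)
  \<comment> \<open>Points in different pieces are at least as far apart as the group of either one
    is wide, so a detour through another piece never shortens a distance. The triangle inequality of
    the reals is used only inside one piece.\<close>
  show "piece_dist p k x z \<le> piece_dist p k x y + piece_dist p k y z" for x y z
  proof (cases "p x = p z")
    case True
    show ?thesis
    proof (cases "p x = p y")
      case True
      have "min 1 \<bar>x - z\<bar> \<le> min 1 \<bar>x - y\<bar> + min 1 \<bar>y - z\<bar>"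
        by linarith
      then show ?thesis
        using True \<open>p x = p z\<close> by (simp add: piece_dist_def divide_right_mono flip: add_divide_distrib)
    next
      case False
      have "piece_dist p k x z \<le> 1 / (1 + real (k (p x)))"
        using \<open>p x = p z\<close> by (intro piece_dist_le_group) simp
      moreover have "1 / (1 + real (k (p x))) \<le> 1"
        by simp
      moreover have "0 \<le> piece_dist p k y z"
        by (simp add: piece_dist_def)
      moreover have "1 / (1 + real (k (p x))) \<le> piece_dist p k x y"
        using False by (simp add: piece_dist_def)
      ultimately show ?thesis by linarith
    qed
  next
    case False
    then consider "p x \<noteq> p y" | "p z \<noteq> p y" by metis
    then show ?thesis
    proof cases
      case 1
      have "0 \<le> piece_dist p k y z"
        by (simp add: piece_dist_def)
      show ?thesis
      proof (cases "k (p x) = k (p y)")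
        case True
        then show ?thesis
          using 1 False \<open>0 \<le> piece_dist p k y z\<close> by (auto simp: piece_dist_def)
      next
        case nk: False
        then show ?thesis
          using 1 False \<open>0 \<le> piece_dist p k y z\<close> piece_dist_le_one[of p k x z]
          by (simp add: piece_dist_def)
      qed
    next
      case 2
      have nn: "0 \<le> piece_dist p k x y"
        by (simp add: piece_dist_def)
      show ?thesis
      proof (cases "k (p z) = k (p y)")
        case True
        then show ?thesis
          using 2 False nn by (auto simp: piece_dist_def)
      next
        case nk: False
        then show ?thesis
          using 2 False nn piece_dist_le_one[of p k x z]
          by (simp add: piece_dist_def)
      qed
    qed
  qed
qed

text \<open>Topologically the space is the disjoint sum of its pieces with their Euclidean
  topologies; the scaling and the grouping \<open>k\<close> affect distances only. Topological
  conditions can thus be checked piece by piece.\<close>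

lemma openin_piece_dist_iff:
  "openin (Metric_space.mtopology S (piece_dist p k)) U \<longleftrightarrow>
     U \<subseteq> S \<and> (\<forall>x\<in>U. \<exists>e>0. \<forall>y\<in>S. p y = p x \<longrightarrow> \<bar>y - x\<bar> < e \<longrightarrow> y \<in> U)"
proof -
  interpret Metric_space S "piece_dist p k"
    by (rule Metric_space_piece_dist)
  have "(\<exists>r>0. mball x r \<subseteq> U) \<longleftrightarrow> (\<exists>e>0. \<forall>y\<in>S. p y = p x \<longrightarrow> \<bar>y - x\<bar> < e \<longrightarrow> y \<in> U)"
    (is "?L \<longleftrightarrow> ?R") if "x \<in> S" for x
  proof
    assume ?L
    then obtain r where r: "r > 0" "mball x r \<subseteq> U" by auto
    have "y \<in> U" if "y \<in> S" "p y = p x" "\<bar>y - x\<bar> < r" for y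
    proof -
      have "piece_dist p k x y \<le> \<bar>x - y\<bar> / 1"
        unfolding piece_dist_def
        using that frac_le[of "\<bar>x - y\<bar>" "min 1 \<bar>x - y\<bar>" 1 "1 + real (k (p x))"] by simp
      then show ?thesis
        using r that \<open>x \<in> S\<close> by (auto simp: in_mball subset_iff)
    qed
    then show ?R using r by auto
  next
    assume ?R
    then obtain e where e: "e > 0" "\<And>y. y \<in> S \<Longrightarrow> p y = p x \<Longrightarrow> \<bar>y - x\<bar> < e \<Longrightarrow> y \<in> U" by auto
    \<comment> \<open>A radius of at most \<open>?w\<close> confines the ball to the piece of
      \<open>x\<close>; there the factor \<open>?w\<close> cancels, and the truncated radius
      \<open>min 1 e\<close> controls the truncated Euclidean distance.\<close>
    let ?w = "1 / (1 + real (k (p x)))"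
    have "y \<in> U" if y: "y \<in> S" "piece_dist p k x y < ?w * min 1 e" for y
    proof -
      have "?w * min 1 e \<le> ?w * 1"
        by (intro mult_left_mono) auto
      then have "p y = p x"
        using y by (intro piece_dist_less_imp_same_piece[of p k x y]) auto
      then have "min 1 \<bar>x - y\<bar> < min 1 e"
        using y by (simp add: piece_dist_def divide_simps split: if_splits)
      then show ?thesis
        using y e \<open>p y = p x\<close> by (auto simp: min_def abs_minus_commute split: if_splits)
    qed
    moreover have "?w * min 1 e > 0" using e by simp
    ultimately show ?L by (auto simp: in_mball subset_iff intro!: exI[of _ "?w * min 1 e"])
  qed
  then show ?thesis
    unfolding openin_mtopology by blast
qed

lemma openin_piece_dist_Int_piece:
  assumes "openin (Metric_space.mtopology S (piece_dist p k)) U"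
  obtains V where "open V" "U \<inter> {x \<in> S. p x = m} = V \<inter> {x \<in> S. p x = m}"
proof
  let ?V = "\<Union>{ball x e | x e. {y \<in> S. p y = m} \<inter> ball x e \<subseteq> U}"
  show "open ?V" by auto
  show "U \<inter> {x \<in> S. p x = m} = ?V \<inter> {x \<in> S. p x = m}"
  proof (intro equalityI subsetI)
    fix x assume x: "x \<in> U \<inter> {x \<in> S. p x = m}"
    then obtain e where e: "e > 0" "\<forall>y\<in>S. p y = p x \<longrightarrow> \<bar>y - x\<bar> < e \<longrightarrow> y \<in> U"
      using assms unfolding openin_piece_dist_iff by blast
    then have "{y \<in> S. p y = m} \<inter> ball x e \<subseteq> U"
      using x by (auto simp: dist_real_def abs_minus_commute)
    then have "x \<in> ?V" using e(1) by (intro UnionI[of "ball x e"]) auto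
    then show "x \<in> ?V \<inter> {x \<in> S. p x = m}" using x by auto
  qed auto
qed

text \<open>The identity from a Euclidean piece into the metric space is continuous. Confinement to
  one piece matters: pieces are open and disjoint, so a compact set meets only finitely many of
  them.\<close>

lemma compactin_piece_dist:
  assumes "compact K" "K \<subseteq> {x \<in> S. p x = m}"
  shows "compactin (Metric_space.mtopology S (piece_dist p k)) K"
proof -
  interpret Metric_space S "piece_dist p k"
    by (rule Metric_space_piece_dist)
  let ?P = "{x \<in> S. p x = m}"
  have "continuous_map (top_of_set ?P) mtopology (\<lambda>x. x)"
    unfolding continuous_map_def
  proof (intro conjI allI impI)
    fix U assume "openin mtopology U"
    from openin_piece_dist_Int_piece[OF this, of m] obtain V where
      "open V" "U \<inter> ?P = V \<inter> ?P" by metis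
    then have "{x \<in> ?P. x \<in> U} = ?P \<inter> V" by blast
    then show "openin (top_of_set ?P) {x \<in> topspace (top_of_set ?P). x \<in> U}"
      using \<open>open V\<close> by (simp add: openin_open_Int)
  qed auto
  moreover have "compactin (top_of_set ?P) K"
    using assms by (simp add: compactin_subtopology)
  ultimately show ?thesis
    using image_compactin by fastforce
qed

section \<open>Regularity of the measure for the piece metric\<close>

lemma suminf_ennreal_halves:
  assumes "0 \<le> e"
  shows "(\<Sum>m. ennreal (e * (1/2) ^ Suc m)) = ennreal e"
  using sums_mult[OF power_half_series, of e] assms
  by (intro suminf_ennreal_eq) auto

text \<open>Only inner approximation by Euclidean compact sets is assumed. Outer approximation
  follows by complementation inside each piece, where finite measure permits subtraction;
  \<open>supp\<close> provides the positivity of open sets.\<close>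

lemma good_metric_piece_dist:
  fixes L :: "real measure"
  assumes borel: "\<And>B. B \<in> sets borel \<Longrightarrow> B \<inter> space L \<in> sets L"
    and p: "\<And>m. {x \<in> space L. p x = m} \<in> sets L"
    and fin: "\<And>m. emeasure L {x \<in> space L. p x = m} \<noteq> \<infinity>"
    and inner: "\<And>A e. A \<in> sets L \<Longrightarrow> emeasure L A \<noteq> \<infinity> \<Longrightarrow> 0 < e \<Longrightarrow>
      \<exists>K. compact K \<and> K \<subseteq> A \<and> emeasure L A \<le> emeasure L K + ennreal e"
    and supp: "\<And>x e. x \<in> space L \<Longrightarrow> 0 < e \<Longrightarrow>
      0 < emeasure L {y \<in> space L. p y = p x \<and> \<bar>y - x\<bar> < e}"
  shows "good_metric L (piece_dist p k)"
proof -
  let ?X = "Metric_space.mtopology (space L) (piece_dist p k)"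
  define P where "P m = {x \<in> space L. p x = m}" for m
  have P[measurable]: "P m \<in> sets L" for m
    using p by (simp add: P_def)
  have disjPA: "disjoint_family (\<lambda>m. P m \<inter> A)" "disjoint_family (\<lambda>m. P m - A)" for A
    by (auto simp: P_def disjoint_family_on_def)
  have UP: "(\<Union>m. P m) = space L"
    by (auto simp: P_def)
  have finP: "emeasure L A \<noteq> \<infinity>" if "A \<subseteq> P m" for A m
    using emeasure_mono[OF that P] fin[of m] by (auto simp: P_def top_unique)
  have compact_sets: "K \<in> sets L" if "compact K" "K \<subseteq> space L" for K
    using borel[of K] that by (simp add: Int_absorb2 borel_compact)
  have emeasure_pieces: "emeasure L A = (\<Sum>m. emeasure L (P m \<inter> A))" if "A \<in> sets L" for A
  proof -
    have "A = (\<Union>m. P m \<inter> A)"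
      using UP sets.sets_into_space[OF that] by blast
    then show ?thesis
      using suminf_emeasure[of "\<lambda>m. P m \<inter> A" L] disjPA that by (auto simp: image_subset_iff)
  qed
  have open_sets: "U \<in> sets L" if U: "openin ?X U" for U
  proof -
    have "U \<inter> P m \<in> sets L" for m
    proof -
      obtain V where "open V" "U \<inter> P m = V \<inter> P m"
        using openin_piece_dist_Int_piece[OF U, of m] unfolding P_def by metis
      moreover have "V \<inter> P m = V \<inter> space L \<inter> P m"
        by (auto simp: P_def)
      ultimately show ?thesis
        using borel[of V] by simp
    qed
    moreover have "U = (\<Union>m. U \<inter> P m)"
      using U by (auto simp: openin_piece_dist_iff P_def)
    ultimately show ?thesis
      by (metis sets.countable_UN image_subset_iff)
  qed
  have outer: "\<exists>U. openin ?X U \<and> A \<subseteq> U \<and> emeasure L U \<le> emeasure L A + ennreal e"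
    if A[measurable]: "A \<in> sets L" and e: "0 < e" for A and e :: real
  proof -
    \<comment> \<open>Removing from \<open>P m\<close> a compact set that nearly exhausts
      \<open>P m - A\<close> leaves an open set that contains \<open>P m \<inter> A\<close>. The
      errors \<open>e * (1/2) ^ Suc m\<close> add up to \<open>e\<close>.\<close>
    have "\<exists>K. compact K \<and> K \<subseteq> P m - A \<and>
        emeasure L (P m - A) \<le> emeasure L K + ennreal (e * (1/2) ^ Suc m)" for m
      using e by (intro inner finP[of _ m]) auto
    then obtain K where K: "\<And>m. compact (K m)" "\<And>m. K m \<subseteq> P m - A"
      "\<And>m. emeasure L (P m - A) \<le> emeasure L (K m) + ennreal (e * (1/2) ^ Suc m)"
      by metis
    have Ks[measurable]: "K m \<in> sets L" for m
      using K(1)[of m] K(2)[of m] by (intro compact_sets) (auto simp: P_def)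
    define U where "U = (\<Union>m. P m - K m)"
    have "openin ?X U"
      unfolding openin_piece_dist_iff
    proof (intro conjI ballI)
      show "U \<subseteq> space L" by (auto simp: U_def P_def)
      fix x assume "x \<in> U"
      then have x: "x \<in> - K (p x)" "x \<in> space L" by (auto simp: U_def P_def)
      have "open (- K (p x))"
        using K(1) by (simp add: compact_imp_closed open_Compl)
      then obtain r where "r > 0" "ball x r \<subseteq> - K (p x)"
        using x openE by blast
      then show "\<exists>r>0. \<forall>y\<in>space L. p y = p x \<longrightarrow> \<bar>y - x\<bar> < r \<longrightarrow> y \<in> U"
        by (intro exI[of _ r]) (auto simp: U_def P_def dist_real_def abs_minus_commute subset_iff)
    qed
    moreover have "A \<subseteq> U"
      using sets.sets_into_space[OF A] K(2) by (force simp: U_def P_def)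
    moreover have "emeasure L U \<le> emeasure L A + ennreal e"
    proof -
      have "emeasure L (P m - K m) \<le> emeasure L (P m \<inter> A) + ennreal (e * (1/2) ^ Suc m)" for m
      proof -
        have "emeasure L (P m - K m) + emeasure L (K m) = emeasure L (P m)"
          using K(2)[of m] by (subst plus_emeasure) (auto intro!: arg_cong[of _ _ "emeasure L"])
        also have "\<dots> = emeasure L (P m \<inter> A) + emeasure L (P m - A)"
          by (subst plus_emeasure) (auto intro!: arg_cong[of _ _ "emeasure L"])
        also have "\<dots> \<le> emeasure L (P m \<inter> A) + (emeasure L (K m) + ennreal (e * (1/2) ^ Suc m))"
          by (intro add_left_mono K)
        finally have "emeasure L (K m) + emeasure L (P m - K m) \<le>
            emeasure L (K m) + (emeasure L (P m \<inter> A) + ennreal (e * (1/2) ^ Suc m))"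
          by (simp add: ac_simps)
        moreover have "emeasure L (K m) \<noteq> \<infinity>"
          using K(2)[of m] by (intro finP[of _ m]) auto
        ultimately show ?thesis
          by (simp add: ennreal_add_left_cancel_le)
      qed
      then have "(\<Sum>m. emeasure L (P m - K m)) \<le>
          (\<Sum>m. emeasure L (P m \<inter> A) + ennreal (e * (1/2) ^ Suc m))"
        by (intro suminf_le) auto
      also have "\<dots> = emeasure L A + ennreal e"
        using e by (simp only: suminf_add[symmetric] summableI suminf_ennreal_halves
            less_imp_le emeasure_pieces[OF A])
      also have "(\<Sum>m. emeasure L (P m - K m)) = emeasure L U"
        unfolding U_def
        by (intro suminf_emeasure) (auto simp: P_def disjoint_family_on_def image_subset_iff p)
      finally show ?thesis .
    qed
    ultimately show ?thesis by blast
  qed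
  have inner': "emeasure L A \<le> (SUP K\<in>{K. compactin ?X K \<and> K \<subseteq> A}. emeasure L K)" (is "_ \<le> ?S")
    if A[measurable]: "A \<in> sets L" for A
  proof -
    \<comment> \<open>A union of compact sets over all pieces need not be compact, so the supremum
      is compared with finite partial sums first.\<close>
    have "(\<Sum>m<n. emeasure L (P m \<inter> A)) \<le> ?S" for n
    proof (rule ennreal_le_epsilon)
      fix e :: real assume e: "0 < e"
      have "\<exists>K. compact K \<and> K \<subseteq> P m \<inter> A \<and>
          emeasure L (P m \<inter> A) \<le> emeasure L K + ennreal (e * (1/2) ^ Suc m)" for m
        using e by (intro inner finP[of _ m]) auto
      then obtain K where K: "\<And>m. compact (K m)" "\<And>m. K m \<subseteq> P m \<inter> A"
        "\<And>m. emeasure L (P m \<inter> A) \<le> emeasure L (K m) + ennreal (e * (1/2) ^ Suc m)"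
        by metis
      have Ks: "K m \<in> sets L" for m
        using K(1)[of m] K(2)[of m] by (intro compact_sets) (auto simp: P_def)
      have "(\<Sum>m<n. emeasure L (P m \<inter> A)) \<le>
          (\<Sum>m<n. emeasure L (K m)) + (\<Sum>m<n. ennreal (e * (1/2) ^ Suc m))"
        unfolding sum.distrib[symmetric] by (intro sum_mono K)
      also have "(\<Sum>m<n. ennreal (e * (1/2) ^ Suc m)) \<le> (\<Sum>m. ennreal (e * (1/2) ^ Suc m))"
        by (intro sum_le_suminf) auto
      also have "\<dots> = ennreal e"
        using e by (intro suminf_ennreal_halves) simp
      also have "(\<Sum>m<n. emeasure L (K m)) = emeasure L (\<Union>m<n. K m)"
      proof (rule sum_emeasure)
        show "disjoint_family_on K {..<n}"
          by (auto simp: P_def disjoint_family_on_def dest!: subsetD[OF K(2)])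
      qed (use Ks in auto)
      also have "\<dots> \<le> ?S"
      proof (rule SUP_upper, safe)
        show "compactin ?X (\<Union>m<n. K m)"
        proof (rule compactin_Union)
          show "finite (K ` {..<n})" by simp
          fix C assume "C \<in> K ` {..<n}"
          then obtain m where "C = K m" by blast
          then show "compactin ?X C"
            using K(1)[of m] K(2)[of m] by (auto intro!: compactin_piece_dist[where m = m] simp: P_def)
        qed
      qed (use K(2) in auto)
      finally show "(\<Sum>m<n. emeasure L (P m \<inter> A)) \<le> ?S + ennreal e"
        by (simp add: add_right_mono)
    qed
    then have "(\<Sum>m. emeasure L (P m \<inter> A)) \<le> ?S"
      by (intro suminf_le_const) auto
    then show ?thesis
      using emeasure_pieces[OF A] by simp
  qed
  have "regular_wrt L (piece_dist p k)"
    unfolding regular_wrt_def Let_def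
  proof (intro conjI allI impI ballI)
    fix U assume "openin ?X U" then show "U \<in> sets L" by (rule open_sets)
  next
    fix A assume A: "A \<in> sets L"
    show "emeasure L A = (INF U\<in>{U. openin ?X U \<and> A \<subseteq> U}. emeasure L U)" (is "_ = ?I")
    proof (rule antisym)
      show "emeasure L A \<le> ?I"
        by (intro INF_greatest) (auto intro!: emeasure_mono open_sets)
      show "?I \<le> emeasure L A"
      proof (rule ennreal_le_epsilon)
        fix e :: real assume "0 < e"
        then obtain U where U: "openin ?X U" "A \<subseteq> U" "emeasure L U \<le> emeasure L A + ennreal e"
          using outer[OF A] by blast
        then have "?I \<le> emeasure L U" by (intro INF_lower) auto
        with U(3) show "?I \<le> emeasure L A + ennreal e" by (rule order_trans[rotated])
      qed
    qed
    show "emeasure L A = (SUP K\<in>{K. compactin ?X K \<and> K \<subseteq> A}. emeasure L K)"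
      using inner'[OF A] A by (intro antisym SUP_least emeasure_mono) auto
  qed
  moreover have "0 < emeasure L U" if U: "openin ?X U" "U \<noteq> {}" for U
  proof -
    obtain x e where x: "x \<in> space L" "e > 0" "\<forall>y\<in>space L. p y = p x \<longrightarrow> \<bar>y - x\<bar> < e \<longrightarrow> y \<in> U"
      using U unfolding openin_piece_dist_iff by blast
    have "0 < emeasure L {y \<in> space L. p y = p x \<and> \<bar>y - x\<bar> < e}"
      using supp x by blast
    also have "\<dots> \<le> emeasure L U"
      using x open_sets[OF U(1)] by (intro emeasure_mono) auto
    finally show ?thesis .
  qed
  ultimately show ?thesis
    by (simp add: good_metric_def Metric_space_piece_dist)
qed
subsection \<open>Transport to the model space\<close>

text \<open>The measure \<open>N\<close> may be infinite on every open set. Cutting it down to the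
  Borel part \<open>main_part N A\<close>, which carries all of the measure of \<open>A\<close>,
  gives a finite Borel measure, and finite Borel measures on Polish spaces are inner
  regular.\<close>

lemma inner_regular_completion:
  fixes N :: "'a::{second_countable_topology, complete_space} measure"
  assumes N: "sets N = sets borel" and A: "A \<in> sets (completion N)"
    and fin: "emeasure (completion N) A \<noteq> \<infinity>" and e: "0 < e"
  obtains K where "compact K" "K \<subseteq> A"
    "emeasure (completion N) A \<le> emeasure (completion N) K + ennreal e"
proof -
  define B where "B = main_part N A"
  have B: "B \<in> sets N" "B \<subseteq> A" "emeasure N B = emeasure (completion N) A"
    using A main_part_null_part_Un[OF A] by (auto simp: B_def simp del: main_part_null_part_Un)
  define D where "D = density N (indicator B)"
  have D: "emeasure D X = emeasure N (B \<inter> X)" if "X \<in> sets N" for X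
    using that B(1) by (simp add: D_def emeasure_density nn_integral_set_ennreal
        flip: indicator_inter_arith)
  have "sets D = sets borel" by (simp add: D_def N)
  moreover have "emeasure D (space D) \<noteq> \<infinity>"
    using D[of "space N"] B fin sets.Int_space_eq2[OF B(1)] by (simp add: D_def)
  ultimately have "emeasure D B = (SUP K\<in>{K. K \<subseteq> B \<and> compact K}. emeasure D K)"
    using B(1) N by (intro inner_regular) auto
  moreover have "emeasure D B \<noteq> \<infinity>"
    using D[OF B(1)] B fin by simp
  ultimately have "\<exists>K\<in>{K. K \<subseteq> B \<and> compact K}. emeasure D B < emeasure D K + ennreal e"
    by (intro SUP_approx_ennreal[OF e]) auto
  then obtain K where K: "K \<subseteq> B" "compact K" "emeasure D B < emeasure D K + ennreal e"
    by auto
  have "K \<in> sets N"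
    using K(2) N by (simp add: borel_compact)
  with K B D[OF B(1)] D[of K] show ?thesis
    by (intro that[of K]) (auto simp: Int_absorb1)
qed

lemma mod_null_iso_emeasure_vimage:
  assumes iso: "mod_null_iso M Y M' Y' \<phi>" and B: "B \<in> sets M'" "B \<subseteq> Y'"
  shows "{x \<in> Y. \<phi> x \<in> B} \<in> sets M" and "emeasure M {x \<in> Y. \<phi> x \<in> B} = emeasure M' B"
proof -
  let ?R = "restrict_space M Y" and ?R' = "restrict_space M' Y'"
  have Y: "Y \<in> sets M" "Y' \<in> sets M'" and \<phi>: "\<phi> \<in> ?R \<rightarrow>\<^sub>M ?R'"
    and distr: "distr ?R ?R' \<phi> = ?R'"
    using iso by (auto simp: mod_null_iso_def)
  have B': "B \<in> sets ?R'"
    using B Y by (simp add: sets_restrict_space_iff)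
  have eq: "\<phi> -` B \<inter> Y = {x \<in> Y. \<phi> x \<in> B}"
    by auto
  show meas: "{x \<in> Y. \<phi> x \<in> B} \<in> sets M"
    using measurable_sets[OF \<phi> B'] Y by (auto simp: eq sets_restrict_space_iff)
  have "emeasure M' B = emeasure (distr ?R ?R' \<phi>) B"
    using B Y by (simp add: distr emeasure_restrict_space)
  also have "\<dots> = emeasure M {x \<in> Y. \<phi> x \<in> B}"
    using B' Y \<phi> by (subst emeasure_distr) (auto simp: eq emeasure_restrict_space)
  finally show "emeasure M {x \<in> Y. \<phi> x \<in> B} = emeasure M' B" by simp
qed

lemma mod_null_iso_sets_image:
  assumes iso: "mod_null_iso M Y M' Y' \<phi>" and A: "A \<in> sets M" "A \<subseteq> Y"
  shows "\<phi> ` A \<in> sets M'" and "emeasure M' (\<phi> ` A) = emeasure M A"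
proof -
  let ?R = "restrict_space M Y" and ?R' = "restrict_space M' Y'"
  have Y: "Y \<in> sets M" "Y' \<in> sets M'" and bij: "bij_betw \<phi> Y Y'"
    and \<psi>: "the_inv_into Y \<phi> \<in> ?R' \<rightarrow>\<^sub>M ?R"
    using iso by (auto simp: mod_null_iso_def)
  have "A \<in> sets ?R"
    using A Y by (simp add: sets_restrict_space_iff)
  from measurable_sets[OF \<psi> this] have "{y \<in> Y'. the_inv_into Y \<phi> y \<in> A} \<in> sets M'"
    using Y by (simp add: sets_restrict_space_iff vimage_def Collect_conj_eq Int_commute)
  also have "{y \<in> Y'. the_inv_into Y \<phi> y \<in> A} = \<phi> ` A"
    using A(2) bij by (auto simp: bij_betw_def the_inv_into_f_f subset_iff image_iff
        intro: f_the_inv_into_f[symmetric] the_inv_into_into)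
  finally show *: "\<phi> ` A \<in> sets M'" .
  have "{x \<in> Y. \<phi> x \<in> \<phi> ` A} = A"
    using A(2) bij by (auto simp: bij_betw_def inj_on_def)
  moreover have "\<phi> ` A \<subseteq> Y'"
    using A(2) bij by (auto simp: bij_betw_def)
  ultimately show "emeasure M' (\<phi> ` A) = emeasure M A"
    using mod_null_iso_emeasure_vimage(2)[OF iso *] by simp
qed

text \<open>The target is cut down to exactly the image of \<open>Z\<close>: leftover points from
  the null part of the model could have null neighbourhoods and would spoil a good metric.\<close>

lemma mod_null_iso_restrict:
  assumes iso: "mod_null_iso M Y M' Y' \<phi>"
    and Z: "Z \<in> sets M" "Z \<subseteq> Y" "space M - Z \<in> null_sets M"
  shows "mod_null_iso M Z (restrict_space M' (\<phi> ` Z)) (\<phi> ` Z) \<phi>"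
proof -
  let ?S = "\<phi> ` Z"
  have Y: "Y \<in> sets M" "Y' \<in> sets M'" and bij: "bij_betw \<phi> Y Y'"
    using iso by (auto simp: mod_null_iso_def)
  have inj: "inj_on \<phi> Z"
    using bij Z(2) by (auto simp: bij_betw_def intro: inj_on_subset)
  have S: "?S \<in> sets M'" "?S \<subseteq> Y'"
    using mod_null_iso_sets_image[OF iso Z(1,2)] bij Z(2) by (auto simp: bij_betw_def)
  have setsS: "B \<in> sets (restrict_space M' ?S) \<longleftrightarrow> B \<subseteq> ?S \<and> B \<in> sets M'" for B
    using S by (simp add: sets_restrict_space_iff)
  have RS: "restrict_space (restrict_space M' ?S) ?S = restrict_space M' ?S"
    using S by (simp add: restrict_restrict_space)
  have sp: "space (restrict_space M' ?S) = ?S" "space (restrict_space M Z) = Z"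
    using S Z by simp_all
  have vimage: "{x \<in> Z. \<phi> x \<in> B} = {x \<in> Y. \<phi> x \<in> B}" if "B \<subseteq> ?S" for B
    using that bij Z(2) by (auto simp: bij_betw_def inj_on_def subset_iff image_iff)
  have \<phi>: "\<phi> \<in> restrict_space M Z \<rightarrow>\<^sub>M restrict_space M' ?S"
  proof (rule measurableI)
    fix B assume "B \<in> sets (restrict_space M' ?S)"
    then have B: "B \<subseteq> ?S" "B \<in> sets M'" by (auto simp: setsS)
    have "\<phi> -` B \<inter> Z = {x \<in> Y. \<phi> x \<in> B}"
      using vimage[OF B(1)] by auto
    moreover have "{x \<in> Y. \<phi> x \<in> B} \<in> sets M"
      using B S by (intro mod_null_iso_emeasure_vimage(1)[OF iso]) auto
    ultimately show "\<phi> -` B \<inter> space (restrict_space M Z) \<in> sets (restrict_space M Z)"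
      using Z by (auto simp: sp sets_restrict_space_iff)
  qed (simp add: sp)
  have \<psi>: "the_inv_into Z \<phi> \<in> restrict_space M' ?S \<rightarrow>\<^sub>M restrict_space M Z"
  proof (rule measurableI)
    show "the_inv_into Z \<phi> x \<in> space (restrict_space M Z)"
      if "x \<in> space (restrict_space M' ?S)" for x
      using that inj by (auto simp: sp the_inv_into_f_f)
    fix A assume "A \<in> sets (restrict_space M Z)"
    then have A: "A \<in> sets M" "A \<subseteq> Z" using Z by (auto simp: sets_restrict_space_iff)
    have "the_inv_into Z \<phi> -` A \<inter> ?S = \<phi> ` A"
      using A(2) inj by (auto simp: the_inv_into_f_f subset_iff)
    then show "the_inv_into Z \<phi> -` A \<inter> space (restrict_space M' ?S) \<in> sets (restrict_space M' ?S)"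
      using mod_null_iso_sets_image(1)[OF iso A(1)] A(2) Z(2) by (auto simp: sp setsS)
  qed
  have "distr (restrict_space M Z) (restrict_space M' ?S) \<phi> = restrict_space M' ?S"
  proof (rule measure_eqI)
    fix B assume "B \<in> sets (distr (restrict_space M Z) (restrict_space M' ?S) \<phi>)"
    then have B': "B \<in> sets (restrict_space M' ?S)" by simp
    then have B: "B \<subseteq> ?S" "B \<in> sets M'" by (auto simp: setsS)
    have "\<phi> -` B \<inter> Z = {x \<in> Y. \<phi> x \<in> B}" "{x \<in> Y. \<phi> x \<in> B} \<subseteq> Z"
      using vimage[OF B(1)] by auto
    moreover have "emeasure M {x \<in> Y. \<phi> x \<in> B} = emeasure M' B"
      using B S by (intro mod_null_iso_emeasure_vimage(2)[OF iso]) auto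
    ultimately show "emeasure (distr (restrict_space M Z) (restrict_space M' ?S) \<phi>) B =
        emeasure (restrict_space M' ?S) B"
      using emeasure_distr[OF \<phi> B'] B S Z by (simp add: sp emeasure_restrict_space)
  qed simp
  then show ?thesis
    using Z S \<phi> \<psi> inj by (simp add: mod_null_iso_def RS sp setsS bij_betw_def)
qed

section \<open>Nonsingular maps and almost everywhere statements\<close>

lemma nonsingular_measurable: "nonsingular M T \<Longrightarrow> T \<in> M \<rightarrow>\<^sub>M M"
  by (simp add: nonsingular_def)

lemma nonsingular_emeasure_vimage:
  assumes "nonsingular M T" "A \<in> sets M"
  shows "emeasure M (T -` A \<inter> space M) = 0 \<longleftrightarrow> emeasure M A = 0"
  using assms unfolding nonsingular_def by blast

lemma nonsingular_AE_compose:
  assumes "nonsingular M T" "AE x in M. P x"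
  shows "AE x in M. P (T x)"
proof -
  obtain N where N: "{x \<in> space M. \<not> P x} \<subseteq> N" "N \<in> null_sets M"
    using assms(2) by (auto elim: AE_E2 simp: eventually_ae_filter)
  then have "T -` N \<inter> space M \<in> null_sets M"
    using assms(1) measurable_sets[OF nonsingular_measurable[OF assms(1)], of N]
    by (simp add: null_sets_def nonsingular_emeasure_vimage)
  moreover have "{x \<in> space M. \<not> P (T x)} \<subseteq> T -` N \<inter> space M"
    using N(1) measurable_space[OF nonsingular_measurable[OF assms(1)]] by auto
  ultimately show ?thesis
    by (rule AE_I')
qed

text \<open>Passing from \<open>T x\<close> back to \<open>x\<close> uses the other half of
  nonsingularity: a measurable set with null preimage is null. This takes the place of an inverse of
  \<open>T\<close>, and it is why \<open>P\<close> must define a measurable set.\<close>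

lemma nonsingular_AE_compose_iff:
  assumes "nonsingular M T" "{x \<in> space M. P x} \<in> sets M"
  shows "(AE x in M. P (T x)) \<longleftrightarrow> (AE x in M. P x)"
proof
  assume *: "AE x in M. P (T x)"
  let ?N = "{x \<in> space M. \<not> P x}"
  have T: "T \<in> M \<rightarrow>\<^sub>M M"
    using assms(1) by (rule nonsingular_measurable)
  have N: "?N \<in> sets M"
    using assms(2) by (rule sets.sets_Collect_neg)
  have eq: "T -` ?N \<inter> space M = {x \<in> space M. \<not> P (T x)}"
    using measurable_space[OF T] by auto
  have "emeasure M (T -` ?N \<inter> space M) = 0"
    using * measurable_sets[OF T N] unfolding eq by (simp add: AE_iff_measurable[OF _ refl])
  then have "emeasure M ?N = 0"
    using nonsingular_emeasure_vimage[OF assms(1) N] by simp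
  then show "AE x in M. P x"
    using N by (simp add: AE_iff_measurable[OF _ refl])
qed (rule nonsingular_AE_compose[OF assms(1)])

lemma nonsingular_funpow:
  assumes "nonsingular M T"
  shows "nonsingular M (T ^^ n)"
proof (induction n)
  case 0
  then show ?case by (auto simp: nonsingular_def Int_absorb2 sets.sets_into_space)
next
  case (Suc n)
  have T: "T \<in> M \<rightarrow>\<^sub>M M" "T ^^ n \<in> M \<rightarrow>\<^sub>M M"
    using assms Suc by (simp_all add: nonsingular_measurable)
  have eq: "(T ^^ Suc n) -` A \<inter> space M = (T ^^ n) -` (T -` A \<inter> space M) \<inter> space M" for A
    using measurable_space[OF T(2)] by auto
  have "T ^^ Suc n \<in> M \<rightarrow>\<^sub>M M"
    using measurable_comp[OF T(2,1)] by simp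
  moreover have "emeasure M ((T ^^ n) -` (T -` A \<inter> space M) \<inter> space M) = 0 \<longleftrightarrow> emeasure M A = 0"
    if "A \<in> sets M" for A
    using nonsingular_emeasure_vimage[OF Suc measurable_sets[OF T(1) that]]
      nonsingular_emeasure_vimage[OF assms that] by simp
  ultimately show ?case
    unfolding nonsingular_def eq by simp
qed

lemma ex_AE_point:
  assumes "AE x in M. P x" "A \<in> sets M" "0 < emeasure M A"
  obtains x where "x \<in> A" "P x"
proof (rule ccontr)
  assume "\<not> thesis"
  with that have "\<And>x. x \<in> A \<Longrightarrow> \<not> P x" by blast
  then have "AE x in M. x \<notin> A"
    using assms(1) by (auto elim: eventually_mono)
  then have "emeasure M A = 0"
    using assms(2) by (simp add: AE_iff_null_sets null_setsD1)
  with assms(3) show False by simp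
qed

text \<open>The map \<open>T'\<close> is the conjugate of \<open>T\<close>. As the space of
  \<open>L\<close> is \<open>S\<close> itself, the formula makes sense at every point;
  \<open>M\<close> exceeds \<open>Y\<close> by a null set, which does not disturb
  nonsingularity.\<close>

lemma isomorphic_systems_transport:
  assumes iso: "mod_null_iso M Y L S \<phi>" and S: "S = space L"
    and ns: "nonsingular M T" and TY: "T ` Y \<subseteq> Y"
  defines "T' \<equiv> \<lambda>y. \<phi> (T (the_inv_into Y \<phi> y))"
  shows "nonsingular L T'" "isomorphic_systems M T L T'"
    "\<And>x n. x \<in> Y \<Longrightarrow> (T ^^ n) x \<in> Y"
    "\<And>x n. x \<in> Y \<Longrightarrow> (T' ^^ n) (\<phi> x) = \<phi> ((T ^^ n) x)"
proof -
  have T: "T \<in> M \<rightarrow>\<^sub>M M"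
    using ns by (rule nonsingular_measurable)
  have Y: "Y \<in> sets M" "space M - Y \<in> null_sets M" and bij: "bij_betw \<phi> Y S"
    using iso by (auto simp: mod_null_iso_def)
  have RL: "restrict_space L S = L"
    unfolding S by (intro measure_eqI) (auto simp: sets_restrict_space_iff emeasure_restrict_space
        dest: sets.sets_into_space[THEN subsetD])
  have inj: "inj_on \<phi> Y" and im: "\<phi> ` Y = S"
    using bij by (auto simp: bij_betw_def)
  have \<phi>: "\<phi> \<in> restrict_space M Y \<rightarrow>\<^sub>M L" and \<psi>: "the_inv_into Y \<phi> \<in> L \<rightarrow>\<^sub>M restrict_space M Y"
    using iso by (auto simp: mod_null_iso_def RL)
  have TR: "T \<in> restrict_space M Y \<rightarrow>\<^sub>M restrict_space M Y"
    using T TY by (intro measurable_restrict_space3) auto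
  have T': "T' \<in> L \<rightarrow>\<^sub>M L"
    unfolding T'_def using measurable_compose[OF measurable_compose[OF \<psi> TR] \<phi>] .
  have conj: "T' (\<phi> x) = \<phi> (T x)" if "x \<in> Y" for x
    using that inj by (simp add: T'_def the_inv_into_f_f)
  show funpow_Y: "(T ^^ n) x \<in> Y" if "x \<in> Y" for x n
    using that TY by (induction n) auto
  show "(T' ^^ n) (\<phi> x) = \<phi> ((T ^^ n) x)" if "x \<in> Y" for x n
    using that funpow_Y by (induction n) (auto simp: conj)
  show "isomorphic_systems M T L T'"
    unfolding isomorphic_systems_def using iso TY conj im
    by (intro exI[of _ Y] exI[of _ S] exI[of _ \<phi>]) (auto simp: image_subset_iff)
  have "emeasure L B = 0 \<longleftrightarrow> emeasure L (T' -` B \<inter> space L) = 0" if B: "B \<in> sets L" for B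
  proof -
    let ?B = "{x \<in> Y. \<phi> x \<in> B}"
    have BS: "B \<subseteq> S" using B sets.sets_into_space S by blast
    note 1 = mod_null_iso_emeasure_vimage[OF iso B BS]
    have T'B: "T' -` B \<inter> space L \<in> sets L" "T' -` B \<inter> space L \<subseteq> S"
      using measurable_sets[OF T' B] by (auto simp: S)
    note 2 = mod_null_iso_emeasure_vimage[OF iso T'B]
    have eq: "{x \<in> Y. \<phi> x \<in> T' -` B \<inter> space L} = (T -` ?B \<inter> space M) \<inter> Y"
      using TY im S sets.sets_into_space[OF Y(1)] by (auto simp: conj)
    have TB: "T -` ?B \<inter> space M \<in> sets M"
      using measurable_sets[OF T 1(1)] .
    have "emeasure M ((T -` ?B \<inter> space M) \<inter> Y) = emeasure M (T -` ?B \<inter> space M)"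
    proof (rule emeasure_eq_AE)
      show "AE x in M. x \<in> (T -` ?B \<inter> space M) \<inter> Y \<longleftrightarrow> x \<in> T -` ?B \<inter> space M"
        using AE_not_in[OF Y(2)] by auto
    qed (use TB Y in auto)
    moreover have "emeasure M ?B = 0 \<longleftrightarrow> emeasure M (T -` ?B \<inter> space M) = 0"
      using nonsingular_emeasure_vimage[OF ns 1(1)] by simp
    ultimately show ?thesis
      unfolding 1(2)[symmetric] 2(2)[symmetric] eq by simp
  qed
  then show "nonsingular L T'"
    using T' unfolding nonsingular_def by blast
qed

text \<open>For a suitable \<open>x\<close> in \<open>P j\<close>, a small ball around its copy lies
  in one piece inside the copy of \<open>P j\<close>. At a return time \<open>x\<close> and almost
  every point of that ball are in \<open>A j\<close> together, hence closer than \<delta>. Such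
  times occur arbitrarily late, against sensitivity.\<close>

lemma sensitive_no_recurrent_sequence:
  fixes M :: "'a measure" and A P :: "nat \<Rightarrow> 'a set"
  assumes leb: "lebesgue_space M" and ns: "nonsingular M T" and sens: "measurably_sensitive M T"
    and A: "\<And>j. A j \<in> sets M" and disj: "disjoint_family A"
    and P: "\<And>j. P j \<in> sets M" "\<And>j. P j \<subseteq> A j" "\<And>j. 0 < emeasure M (P j)"
    and rec: "\<And>j n\<^sub>0. \<exists>n\<ge>n\<^sub>0. AE x in M. x \<in> P j \<longrightarrow> (T ^^ n) x \<in> A j"
  shows False
proof -
  interpret sigma_finite_measure M
    using leb by (simp add: lebesgue_space_def)
  obtain N :: "real measure" and Y0 Y0' \<phi> where N: "sets N = sets borel"
    and iso0: "mod_null_iso M Y0 (completion N) Y0' \<phi>"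
    using leb unfolding lebesgue_space_def by blast
  obtain F :: "nat \<Rightarrow> 'a set" where F: "range F \<subseteq> sets M" "(\<Union>i. F i) = space M"
    "\<And>i. emeasure M (F i) \<noteq> \<infinity>" "disjoint_family F"
    using sigma_finite_disjoint by blast
  have Fs: "F i \<in> sets M" for i using F(1) by auto
  note [measurable] = A P(1) Fs
  have T[measurable]: "T ^^ n \<in> M \<rightarrow>\<^sub>M M" for n
    using nonsingular_measurable[OF nonsingular_funpow[OF ns]] .
  have uniq: "i = j" if "x \<in> A i" "x \<in> A j" for x i j
    using disj that by (auto simp: disjoint_family_on_def)

  \<comment> \<open>The pieces \<open>q = m\<close> refine the sets \<open>A\<^sub>j\<close> by sets \<open>F\<^sub>i\<close> of finite measure and by the \<open>P\<^sub>j\<close>;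
    the sets \<open>A\<^sub>j\<close> are the groups \<open>j + 1\<close>, and the points outside all of them form group \<open>0\<close>.\<close>
  define g where "g x = (if \<exists>j. x \<in> A j then Suc (LEAST j. x \<in> A j) else 0)" for x
  define s where "s x = (LEAST i. x \<in> F i)" for x
  define b where "b x = (if \<exists>j. x \<in> P j then 1 else 0::nat)" for x
  define q where "q x = prod_encode (g x, prod_encode (s x, b x))" for x
  define k where "k m = fst (prod_decode m)" for m
  have g[measurable]: "g \<in> M \<rightarrow>\<^sub>M count_space UNIV" and s[measurable]: "s \<in> M \<rightarrow>\<^sub>M count_space UNIV"
    and b[measurable]: "b \<in> M \<rightarrow>\<^sub>M count_space UNIV"
    unfolding g_def s_def b_def by measurable
  have q[measurable]: "q \<in> M \<rightarrow>\<^sub>M count_space UNIV"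
    unfolding q_def by measurable
  have kq: "k (q x) = g x" for x
    by (simp add: k_def q_def)
  have qD: "g x = g y" "b x = b y" if "q x = q y" for x y
    using that by (auto simp: q_def)
  have gA: "g x = Suc j \<longleftrightarrow> x \<in> A j" for x j
  proof
    assume "g x = Suc j"
    then have *: "\<exists>j. x \<in> A j" "(LEAST j. x \<in> A j) = j"
      by (auto simp: g_def split: if_splits)
    from LeastI_ex[OF *(1)] *(2) show "x \<in> A j" by simp
  next
    assume "x \<in> A j"
    moreover from this have "(LEAST j. x \<in> A j) = j"
      by (intro Least_equality) (auto dest: uniq)
    ultimately show "g x = Suc j" by (auto simp: g_def)
  qed
  have qP: "y \<in> P j" if "x \<in> P j" "q y = q x" for x y j
  proof -
    have "b y = 1" "g y = Suc j"
      using qD[OF that(2)] that(1) P(2) gA by (auto simp: b_def)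
    then obtain i where "y \<in> P i" "y \<in> A j"
      using gA by (auto simp: b_def split: if_splits)
    with P(2) uniq show ?thesis by blast
  qed
  have qfin: "emeasure M {x \<in> space M. q x = m} \<noteq> \<infinity>" for m
  proof -
    have "x \<in> F (fst (prod_decode (snd (prod_decode m))))" if "x \<in> space M" "q x = m" for x
    proof -
      have "\<exists>i. x \<in> F i" using F(2) that(1) by auto
      from LeastI_ex[OF this] show ?thesis using that(2) by (auto simp: q_def s_def)
    qed
    then have "emeasure M {x \<in> space M. q x = m} \<le> emeasure M (F (fst (prod_decode (snd (prod_decode m)))))"
      by (intro emeasure_mono Fs) auto
    then show ?thesis using F(3) by (auto simp: top_unique)
  qed

  have Y0: "Y0 \<in> sets M" "space M - Y0 \<in> null_sets M"
    using iso0 by (auto simp: mod_null_iso_def)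
  \<comment> \<open>Discarding the null sets among the \<open>W t\<close> leaves the points all of whose neighbourhoods have
    positive measure; \<open>Y\<close> is the forward-invariant part of what remains.\<close>
  define W where "W = (\<lambda>(u, v, m). {x \<in> Y0. \<phi> x \<in> {real_of_rat u<..<real_of_rat v} \<and> q x = m})"
  have W: "W t \<in> sets M" for t
  proof -
    obtain u v m where t: "t = (u, v, m)" by (cases t)
    let ?I = "{real_of_rat u<..<real_of_rat v}"
    have Y0': "Y0' \<in> sets (completion N)" "\<phi> ` Y0 = Y0'"
      using iso0 by (auto simp: mod_null_iso_def bij_betw_def)
    have "?I \<inter> Y0' \<in> sets (completion N)"
      using Y0' N by auto
    then have "{x \<in> Y0. \<phi> x \<in> ?I \<inter> Y0'} \<in> sets M"
      by (intro mod_null_iso_emeasure_vimage(1)[OF iso0]) auto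
    moreover have "W t = {x \<in> Y0. \<phi> x \<in> ?I \<inter> Y0'} \<inter> {x \<in> space M. q x = m}"
      using Y0'(2) sets.sets_into_space[OF Y0(1)] by (auto simp: W_def t)
    ultimately show ?thesis by simp
  qed
  define G where "G = {x \<in> Y0. \<forall>t. W t \<in> null_sets M \<longrightarrow> x \<notin> W t}"
  define Y where "Y = {x \<in> space M. \<forall>n. (T ^^ n) x \<in> G}"
  have G[measurable]: "G \<in> sets M"
  proof -
    have "G = Y0 - (\<Union>t\<in>{t. W t \<in> null_sets M}. W t)"
      by (auto simp: G_def)
    then show ?thesis using W Y0 by (auto intro!: sets.countable_UN')
  qed
  have "AE x in M. x \<in> G"
  proof -
    \<comment> \<open>The index \<open>t\<close> consists of two rationals and a natural number, so
      only countably many null sets are discarded.\<close>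
    have "AE x in M. \<forall>t. W t \<in> null_sets M \<longrightarrow> x \<notin> W t"
      by (subst AE_all_countable) (auto intro: AE_not_in)
    then show ?thesis
      using AE_not_in[OF Y0(2)] AE_space by eventually_elim (auto simp: G_def)
  qed
  then have "AE x in M. (T ^^ n) x \<in> G" for n
    by (rule nonsingular_AE_compose[OF nonsingular_funpow[OF ns]])
  then have "AE x in M. \<forall>n. (T ^^ n) x \<in> G"
    by (simp add: AE_all_countable)
  then have AEY: "AE x in M. x \<in> Y"
    using AE_space by eventually_elim (simp add: Y_def)
  have "Y = (\<Inter>n. (T ^^ n) -` G \<inter> space M)"
    by (auto simp: Y_def)
  then have Ys[measurable]: "Y \<in> sets M"
    using measurable_sets[OF T G] by auto
  have Ynull: "space M - Y \<in> null_sets M"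
    using AEY by (subst AE_iff_null_sets) auto
  have YG: "Y \<subseteq> G" unfolding Y_def by (force dest: spec[of _ 0])
  then have YY0: "Y \<subseteq> Y0" by (auto simp: G_def)
  have TY: "T ` Y \<subseteq> Y"
  proof safe
    fix x assume x: "x \<in> Y"
    then have "(T ^^ Suc n) x \<in> G" for n unfolding Y_def by blast
    then have "(T ^^ n) (T x) \<in> G" for n by (simp add: funpow_swap1)
    moreover have "T x \<in> space M"
      using x measurable_space[OF nonsingular_measurable[OF ns]] by (auto simp: Y_def)
    ultimately show "T x \<in> Y" by (simp add: Y_def)
  qed

  define S where "S = \<phi> ` Y"
  define L where "L = restrict_space (completion N) S"
  have iso: "mod_null_iso M Y L S \<phi>"
    unfolding L_def S_def using iso0 Ys YY0 Ynull by (rule mod_null_iso_restrict)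
  have Ssets: "S \<in> sets (completion N)"
    unfolding S_def using iso0 Ys YY0 by (rule mod_null_iso_sets_image)
  have SC: "S \<inter> space (completion N) \<in> sets (completion N)"
    by (rule sets.Int[OF Ssets sets.top])
  have spL: "space L = S"
    unfolding L_def using Ssets by (rule space_restrict_space2)
  have setsL: "B \<in> sets L \<longleftrightarrow> B \<subseteq> S \<and> B \<in> sets (completion N)" for B
    using sets_restrict_space_iff[OF SC] by (simp add: L_def)
  have emL: "emeasure L B = emeasure (completion N) B" if "B \<subseteq> S" for B
    using emeasure_restrict_space[OF SC that] by (simp add: L_def)
  have inj: "inj_on \<phi> Y" using iso by (auto simp: mod_null_iso_def bij_betw_def)
  define \<psi> where "\<psi> = the_inv_into Y \<phi>"
  have \<psi>: "\<psi> (\<phi> x) = x" if "x \<in> Y" for x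
    using that inj by (simp add: \<psi>_def the_inv_into_f_f)
  define p where "p y = q (\<psi> y)" for y
  define d where "d = piece_dist p k"
  define T' where "T' = (\<lambda>y. \<phi> (T (the_inv_into Y \<phi> y)))"
  note transport = isomorphic_systems_transport[OF iso spL[symmetric] ns TY, folded T'_def]

  have pieces: "{y \<in> space L. p y = m} = \<phi> ` {x \<in> Y. q x = m}" for m
    by (auto simp: spL S_def p_def \<psi>)
  have Yq: "{x \<in> Y. q x = m} \<in> sets M" for m
    using sets.sets_into_space[OF Ys] by measurable
  have "good_metric L d"
    unfolding d_def
  proof (rule good_metric_piece_dist)
    show "B \<inter> space L \<in> sets L" if "B \<in> sets borel" for B
      using that Ssets N by (auto simp: spL setsL)
    show "{x \<in> space L. p x = m} \<in> sets L" for m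
      unfolding pieces by (rule mod_null_iso_sets_image(1)[OF iso Yq]) auto
    show "emeasure L {x \<in> space L. p x = m} \<noteq> \<infinity>" for m
    proof -
      have "emeasure L {x \<in> space L. p x = m} = emeasure M {x \<in> Y. q x = m}"
        unfolding pieces by (rule mod_null_iso_sets_image(2)[OF iso Yq]) auto
      also have "\<dots> \<le> emeasure M {x \<in> space M. q x = m}"
        using sets.sets_into_space[OF Ys] by (intro emeasure_mono) auto
      finally show ?thesis using qfin[of m] by (auto simp: top_unique)
    qed
    show "\<exists>K. compact K \<and> K \<subseteq> B \<and> emeasure L B \<le> emeasure L K + ennreal e"
      if B: "B \<in> sets L" "emeasure L B \<noteq> \<infinity>" and "0 < e" for B e
    proof -
      have B': "B \<subseteq> S" "B \<in> sets (completion N)" using B(1) by (auto simp: setsL)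
      then obtain K where K: "compact K" "K \<subseteq> B"
        "emeasure (completion N) B \<le> emeasure (completion N) K + ennreal e"
        using inner_regular_completion[OF N B'(2) _ \<open>0 < e\<close>] B(2) by (auto simp: emL)
      then show ?thesis using B'(1) emL[OF B'(1)] emL[of K] by auto
    qed
    show "0 < emeasure L {y \<in> space L. p y = p x \<and> \<bar>y - x\<bar> < e}"
      if x: "x \<in> space L" and e: "0 < e" for x e
    proof -
      \<comment> \<open>A rational interval around \<open>x\<close> inside the
        \<open>e\<close>-neighbourhood gives a set \<open>W t\<close> that contains
        \<open>z\<close>; it cannot be null because \<open>z\<close> survived the removal defining
        \<open>G\<close>.\<close>
      obtain z where z: "z \<in> Y" "x = \<phi> z" using x by (auto simp: spL S_def)
      obtain u where u: "x - e < real_of_rat u" "real_of_rat u < x"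
        using of_rat_dense[of "x - e" x] e by auto
      obtain v where v: "x < real_of_rat v" "real_of_rat v < x + e"
        using of_rat_dense[of x "x + e"] e by auto
      let ?W = "W (u, v, q z)"
      have "z \<in> ?W" using z u v YY0 by (auto simp: W_def)
      then have "?W \<notin> null_sets M" using z(1) YG by (auto simp: G_def)
      then have "0 < emeasure M ?W" using W[of "(u, v, q z)"] by (auto simp: zero_less_iff_neq_zero)
      also have "emeasure M ?W = emeasure M (?W \<inter> Y)"
        using AEY W Ys by (intro emeasure_eq_AE) auto
      also have "\<dots> = emeasure L (\<phi> ` (?W \<inter> Y))"
        using W Ys by (intro mod_null_iso_sets_image(2)[OF iso, symmetric]) auto
      also have "\<dots> \<le> emeasure L {y \<in> space L. p y = p x \<and> \<bar>y - x\<bar> < e}"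
      proof (rule emeasure_mono)
        show "\<phi> ` (?W \<inter> Y) \<subseteq> {y \<in> space L. p y = p x \<and> \<bar>y - x\<bar> < e}"
          using u v z by (auto simp: W_def spL S_def p_def \<psi>)
        have "\<phi> ` {y \<in> Y. q y = q z} \<inter> ball x e \<in> sets L"
          using mod_null_iso_sets_image(1)[OF iso Yq] N
          by (auto simp: setsL)
        moreover have "\<phi> ` {y \<in> Y. q y = q z} \<inter> ball x e =
            {y \<in> space L. p y = p x \<and> \<bar>y - x\<bar> < e}"
          using z by (auto simp: pieces[symmetric] p_def \<psi> dist_real_def abs_minus_commute)
        ultimately show "{y \<in> space L. p y = p x \<and> \<bar>y - x\<bar> < e} \<in> sets L" by simp
      qed
      finally show ?thesis .
    qed
  qed
  then obtain \<delta> where \<delta>: "\<delta> > 0" and sensitive: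
    "\<And>x \<epsilon>. x \<in> space L \<Longrightarrow> \<epsilon> > 0 \<Longrightarrow> \<exists>N::nat. \<forall>n\<ge>N.
        0 < emeasure L {y \<in> Metric_space.mball (space L) d x \<epsilon>. d ((T' ^^ n) x) ((T' ^^ n) y) > \<delta>}"
    using sens transport(1,2) unfolding measurably_sensitive_def by blast
  \<comment> \<open>\<open>A j\<close> is group \<open>Suc j\<close>, since \<open>0\<close> is
    reserved for the points outside all these sets; this is the bound on its diameter.\<close>
  obtain j where j: "1 / (1 + real (Suc j)) < \<delta>"
  proof -
    obtain j where "inverse (real (Suc j)) < \<delta>" using reals_Archimedean[OF \<delta>] by blast
    moreover have "1 / (1 + real (Suc j)) \<le> inverse (real (Suc j))"
      by (simp add: field_simps)
    ultimately show ?thesis using that[of j] by linarith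
  qed
  \<comment> \<open>The threshold \<open>n\<^sub>0\<close> will depend on \<open>x\<close>, so
    \<open>x\<close> is fixed before the time. It must therefore be good for all times in
    \<open>R\<close> simultaneously, which costs only countably many null sets.\<close>
  define R where "R = {n. AE x in M. x \<in> P j \<longrightarrow> (T ^^ n) x \<in> A j}"
  have "AE x in M. \<forall>n. n \<in> R \<longrightarrow> x \<in> P j \<longrightarrow> (T ^^ n) x \<in> A j"
    unfolding AE_all_countable by (simp add: R_def)
  with AEY have "AE x in M. x \<in> Y \<and> (\<forall>n. n \<in> R \<longrightarrow> x \<in> P j \<longrightarrow> (T ^^ n) x \<in> A j)"
    by eventually_elim auto
  then obtain x where *: "x \<in> P j" "x \<in> Y \<and> (\<forall>n. n \<in> R \<longrightarrow> x \<in> P j \<longrightarrow> (T ^^ n) x \<in> A j)"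
    using P(1,3)[of j] by (rule ex_AE_point)
  then have x: "x \<in> P j" "x \<in> Y" "\<And>n. n \<in> R \<Longrightarrow> (T ^^ n) x \<in> A j"
    by auto
  \<comment> \<open>With this radius the ball stays in the piece of \<open>x\<close>, and by
    \<open>qP\<close> a piece that meets \<open>P j\<close> lies inside it.\<close>
  define \<epsilon> where "\<epsilon> = 1 / (1 + real (k (p (\<phi> x))))"
  have "\<phi> x \<in> space L" "\<epsilon> > 0" using x by (auto simp: spL S_def \<epsilon>_def)
  from sensitive[OF this] obtain n\<^sub>0 where n\<^sub>0: "\<forall>n\<ge>n\<^sub>0. 0 < emeasure L
      {y \<in> Metric_space.mball (space L) d (\<phi> x) \<epsilon>. d ((T' ^^ n) (\<phi> x)) ((T' ^^ n) y) > \<delta>}"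
    by (rule exE)
  obtain n where n: "n \<ge> n\<^sub>0" "n \<in> R" using rec[of n\<^sub>0 j] by (auto simp: R_def)
  define Z where "Z = {z \<in> Y. z \<in> P j \<and> (T ^^ n) z \<notin> A j}"
  have Z: "Z \<in> sets M"
    unfolding Z_def using sets.sets_into_space[OF Ys] by measurable
  have "AE x in M. x \<notin> Z"
    using n(2) unfolding R_def mem_Collect_eq by eventually_elim (auto simp: Z_def)
  then have "emeasure M Z = 0" using AE_iff_null_sets[OF Z] by auto
  then have Z0: "emeasure L (\<phi> ` Z) = 0" and Zs: "\<phi> ` Z \<in> sets L"
    using mod_null_iso_sets_image[OF iso Z] by (auto simp: Z_def)
  interpret L: Metric_space "space L" d
    unfolding d_def by (rule Metric_space_piece_dist)
  have "y \<in> \<phi> ` Z" if y: "y \<in> L.mball (\<phi> x) \<epsilon>" and far: "d ((T' ^^ n) (\<phi> x)) ((T' ^^ n) y) > \<delta>" for y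
  proof -
    have y': "y \<in> space L" "d (\<phi> x) y < \<epsilon>"
      using y unfolding L.in_mball by auto
    then obtain z where z: "z \<in> Y" "y = \<phi> z"
      by (auto simp: spL S_def)
    have "p (\<phi> z) = p (\<phi> x)"
      using y'(2) z piece_dist_less_imp_same_piece[of p k "\<phi> x" "\<phi> z"] by (simp add: d_def \<epsilon>_def)
    then have "q z = q x" using z x by (simp add: p_def \<psi>)
    then have "z \<in> P j" using qP x(1) by blast
    moreover have "(T ^^ n) z \<notin> A j"
    proof
      assume "(T ^^ n) z \<in> A j"
      then have *: "k (p (\<phi> ((T ^^ n) z))) = Suc j" "k (p (\<phi> ((T ^^ n) x))) = Suc j"
        using x(3)[OF n(2)] transport(3) z x by (simp_all add: p_def \<psi> kq gA)
      then have "d (\<phi> ((T ^^ n) x)) (\<phi> ((T ^^ n) z)) \<le> 1 / (1 + real (Suc j))"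
        using piece_dist_le_group[of k p "\<phi> ((T ^^ n) x)" "\<phi> ((T ^^ n) z)"] by (simp add: d_def)
      then show False using far j z x by (simp add: transport(4))
    qed
    ultimately show ?thesis using z by (auto simp: Z_def)
  qed
  \<comment> \<open>Monotonicity asks only the larger set, the null image of \<open>Z\<close>, to be
    measurable.\<close>
  then have "emeasure L {y \<in> L.mball (\<phi> x) \<epsilon>. d ((T' ^^ n) (\<phi> x)) ((T' ^^ n) y) > \<delta>} \<le> emeasure L (\<phi> ` Z)"
    by (intro emeasure_mono Zs) auto
  with n\<^sub>0 n(1) Z0 show False by auto
qed
subsection \<open>Periodic sets\<close>

lemma eq_mod_null_iff_AE:
  assumes "A \<in> sets M" "B \<in> sets M"
  shows "eq_mod_null M A B \<longleftrightarrow> (AE x in M. x \<in> A \<longleftrightarrow> x \<in> B)"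
proof -
  have "sym_diff A B \<in> sets M" using assms by auto
  then have "eq_mod_null M A B \<longleftrightarrow> (AE x in M. x \<notin> sym_diff A B)"
    unfolding eq_mod_null_def by (rule AE_iff_null_sets)
  also have "\<dots> \<longleftrightarrow> (AE x in M. x \<in> A \<longleftrightarrow> x \<in> B)"
    by (intro AE_cong) auto
  finally show ?thesis .
qed

lemma invariant_set_iff_AE:
  assumes "S \<in> M \<rightarrow>\<^sub>M M"
  shows "invariant_set M S A \<longleftrightarrow> A \<in> sets M \<and> (AE x in M. S x \<in> A \<longleftrightarrow> x \<in> A)"
proof -
  have "eq_mod_null M (S -` A \<inter> space M) A \<longleftrightarrow> (AE x in M. S x \<in> A \<longleftrightarrow> x \<in> A)"
    if "A \<in> sets M"
    using eq_mod_null_iff_AE[OF measurable_sets[OF assms that] that]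
    by (simp cong: AE_cong)
  then show ?thesis by (auto simp: invariant_set_def)
qed

lemma emeasure_pos_iff_AE:
  "A \<in> sets M \<Longrightarrow> 0 < emeasure M A \<longleftrightarrow> \<not> (AE x in M. x \<notin> A)"
  by (simp add: AE_iff_null_sets[symmetric] null_sets_def zero_less_iff_neq_zero)

lemma AE_compose_funpow:
  "nonsingular M T \<Longrightarrow> AE x in M. P x \<Longrightarrow> AE x in M. P ((T ^^ n) x)"
  by (rule nonsingular_AE_compose[OF nonsingular_funpow])

lemma AE_notin_compose_funpow_iff:
  assumes ns: "nonsingular M T" and "A \<in> sets M"
  shows "(AE x in M. (T ^^ n) x \<notin> A) \<longleftrightarrow> (AE x in M. x \<notin> A)"
proof (rule nonsingular_AE_compose_iff[OF nonsingular_funpow[OF ns]])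
  show "{x \<in> space M. x \<notin> A} \<in> sets M"
    using sets.compl_sets[OF assms(2)] by (simp add: set_diff_eq)
qed

lemma sets_vimage_funpow:
  assumes "nonsingular M T" "A \<in> sets M"
  shows "{x \<in> space M. (T ^^ n) x \<in> A} \<in> sets M"
  using measurable_sets[OF nonsingular_measurable[OF nonsingular_funpow[OF assms(1)]] assms(2)]
  by (simp add: vimage_def Int_def conj_commute)

lemma invariant_set_funpow:
  assumes ns: "nonsingular M S" and inv: "invariant_set M S A"
  shows "invariant_set M (S ^^ k) A"
proof -
  note meas = nonsingular_measurable[OF nonsingular_funpow[OF ns]]
  have A: "A \<in> sets M" "AE x in M. S x \<in> A \<longleftrightarrow> x \<in> A"
    using inv by (auto simp: invariant_set_iff_AE[OF nonsingular_measurable[OF ns]])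
  have "AE x in M. (S ^^ k) x \<in> A \<longleftrightarrow> x \<in> A"
  proof (induction k)
    case (Suc k)
    then show ?case
      using AE_compose_funpow[OF ns A(2), of k] by eventually_elim simp
  qed simp
  then show ?thesis
    using A(1) by (simp add: invariant_set_iff_AE[OF meas])
qed

text \<open>The period depends on the set. Finitely many periodic sets share a period, countably
  many need not, so in general this is an algebra and not a \<sigma>-algebra.\<close>

definition periodic_set :: "'a measure \<Rightarrow> ('a \<Rightarrow> 'a) \<Rightarrow> 'a set \<Rightarrow> bool" where
  "periodic_set M T A \<longleftrightarrow> (\<exists>m>0. invariant_set M (T ^^ m) A)"

text \<open>Inclusion and nullness are taken almost everywhere, which gives an atom of the algebra
  modulo null sets without forming the quotient.\<close>

definition periodic_atom :: "'a measure \<Rightarrow> ('a \<Rightarrow> 'a) \<Rightarrow> 'a set \<Rightarrow> bool" where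
  "periodic_atom M T A \<longleftrightarrow>
     periodic_set M T A \<and> \<not> (AE x in M. x \<notin> A) \<and>
     (\<forall>B. periodic_set M T B \<longrightarrow> (AE x in M. x \<in> B \<longrightarrow> x \<in> A) \<longrightarrow>
        (AE x in M. x \<notin> B) \<or> (AE x in M. x \<in> A \<longrightarrow> x \<in> B))"

lemma periodic_set_iff_AE:
  assumes "nonsingular M T"
  shows "periodic_set M T A \<longleftrightarrow> A \<in> sets M \<and> (\<exists>m>0. AE x in M. (T ^^ m) x \<in> A \<longleftrightarrow> x \<in> A)"
  unfolding periodic_set_def
  by (auto simp: invariant_set_iff_AE[OF nonsingular_measurable[OF nonsingular_funpow[OF assms]]])

lemma invariant_imp_AE_mult:
  assumes ns: "nonsingular M T" and "A \<in> sets M" "AE x in M. (T ^^ m) x \<in> A \<longleftrightarrow> x \<in> A"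
  shows "AE x in M. (T ^^ (m * k)) x \<in> A \<longleftrightarrow> x \<in> A"
proof -
  note meas = nonsingular_measurable[OF nonsingular_funpow[OF ns]]
  have "invariant_set M ((T ^^ m) ^^ k) A"
    using assms by (intro invariant_set_funpow[OF nonsingular_funpow[OF ns]]) (simp add: invariant_set_iff_AE[OF meas])
  then show ?thesis
    by (simp add: funpow_mult invariant_set_iff_AE[OF meas])
qed

lemma periodic_set_common_period:
  assumes ns: "nonsingular M T" and "periodic_set M T A" "periodic_set M T B"
  obtains m where "m > 0" "AE x in M. (T ^^ m) x \<in> A \<longleftrightarrow> x \<in> A"
    "AE x in M. (T ^^ m) x \<in> B \<longleftrightarrow> x \<in> B"
proof -
  obtain i where i: "i > 0" "A \<in> sets M" "AE x in M. (T ^^ i) x \<in> A \<longleftrightarrow> x \<in> A"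
    using assms(2) unfolding periodic_set_iff_AE[OF ns] by blast
  obtain j where j: "j > 0" "B \<in> sets M" "AE x in M. (T ^^ j) x \<in> B \<longleftrightarrow> x \<in> B"
    using assms(3) unfolding periodic_set_iff_AE[OF ns] by blast
  show ?thesis
    using i(1) j(1) invariant_imp_AE_mult[OF ns i(2,3), of j]
      invariant_imp_AE_mult[OF ns j(2,3), of i] by (intro that[of "i * j"]) (simp_all add: mult.commute)
qed

lemma periodic_set_Int:
  assumes ns: "nonsingular M T" and "periodic_set M T A" "periodic_set M T B"
  shows "periodic_set M T (A \<inter> B)"
proof -
  obtain m where m: "m > 0" "AE x in M. (T ^^ m) x \<in> A \<longleftrightarrow> x \<in> A"
    "AE x in M. (T ^^ m) x \<in> B \<longleftrightarrow> x \<in> B"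
    using periodic_set_common_period[OF assms] .
  from m(2,3) have "AE x in M. (T ^^ m) x \<in> A \<inter> B \<longleftrightarrow> x \<in> A \<inter> B"
    by eventually_elim auto
  then show ?thesis
    using m(1) assms(2,3) unfolding periodic_set_iff_AE[OF ns] by blast
qed

lemma periodic_set_Diff:
  assumes ns: "nonsingular M T" and "periodic_set M T A" "periodic_set M T B"
  shows "periodic_set M T (A - B)"
proof -
  obtain m where m: "m > 0" "AE x in M. (T ^^ m) x \<in> A \<longleftrightarrow> x \<in> A"
    "AE x in M. (T ^^ m) x \<in> B \<longleftrightarrow> x \<in> B"
    using periodic_set_common_period[OF assms] .
  from m(2,3) have "AE x in M. (T ^^ m) x \<in> A - B \<longleftrightarrow> x \<in> A - B"
    by eventually_elim auto
  then show ?thesis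
    using m(1) assms(2,3) unfolding periodic_set_iff_AE[OF ns] by blast
qed

lemma AE_vimage_funpow:
  assumes ns: "nonsingular M T" and "AE x in M. (T ^^ m) x \<in> A \<longleftrightarrow> x \<in> A"
  shows "AE x in M. (T ^^ m) x \<in> {x \<in> space M. (T ^^ i) x \<in> A} \<longleftrightarrow>
      x \<in> {x \<in> space M. (T ^^ i) x \<in> A}"
proof -
  have comm: "(T ^^ m) ((T ^^ i) x) = (T ^^ i) ((T ^^ m) x)" for x
    by (metis add.commute comp_apply funpow_add)
  show ?thesis
    using AE_compose_funpow[OF ns assms(2), of i] AE_space
    by eventually_elim
      (use measurable_space[OF nonsingular_measurable[OF nonsingular_funpow[OF ns]]] in \<open>auto simp: comm\<close>)
qed

lemma periodic_set_vimage:
  assumes ns: "nonsingular M T" and "periodic_set M T A"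
  shows "periodic_set M T {x \<in> space M. (T ^^ i) x \<in> A}"
  using assms(2) sets_vimage_funpow[OF ns, of A i] AE_vimage_funpow[OF ns, of _ A i]
  unfolding periodic_set_iff_AE[OF ns] by blast

text \<open>Without an atom there is an infinite chain of periodic sets, each smaller than the last
  by a non-null amount. The successive differences are disjoint and periodic, and each returns to
  itself at all multiples of its period.\<close>

lemma ex_periodic_atom:
  assumes leb: "lebesgue_space M" and ns: "nonsingular M T" and sens: "measurably_sensitive M T"
    and pos: "0 < emeasure M (space M)"
  obtains A where "periodic_atom M T A"
proof (rule ccontr)
  assume "\<not> thesis"
  with that have no_atom: "\<not> periodic_atom M T A" for A by blast
  let ?Q = "\<lambda>A. periodic_set M T A \<and> \<not> (AE x in M. x \<notin> A)"
  have "\<exists>A. \<forall>n. ?Q (A n) \<and> (A (Suc n) \<subseteq> A n \<and> \<not> (AE x in M. x \<notin> A n - A (Suc n)))"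
  proof (rule dependent_nat_choice)
    have "periodic_set M T (space M)"
      using measurable_space[OF nonsingular_measurable[OF ns]]
      unfolding periodic_set_iff_AE[OF ns] by (auto intro!: exI[of _ 1])
    moreover have "\<not> (AE x in M. x \<notin> space M)"
      using pos emeasure_pos_iff_AE[of "space M" M] by blast
    ultimately show "\<exists>A. ?Q A" by blast
  next
    fix A and n :: nat assume A: "?Q A"
    then obtain B where B: "periodic_set M T B" "AE x in M. x \<in> B \<longrightarrow> x \<in> A"
      "\<not> (AE x in M. x \<notin> B)" "\<not> (AE x in M. x \<in> A \<longrightarrow> x \<in> B)"
      using no_atom[of A] unfolding periodic_atom_def by blast
    \<comment> \<open>\<open>B\<close> lies in \<open>A\<close> only almost everywhere. Intersecting
      makes the chain decrease as sets, so that its differences are literally disjoint.\<close>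
    have "periodic_set M T (A \<inter> B)"
      using ns A B(1) by (intro periodic_set_Int) auto
    moreover have "\<not> (AE x in M. x \<notin> A \<inter> B)"
    proof
      assume "AE x in M. x \<notin> A \<inter> B"
      with B(2) have "AE x in M. x \<notin> B" by eventually_elim auto
      with B(3) show False ..
    qed
    moreover have "\<not> (AE x in M. x \<notin> A - (A \<inter> B))"
      using B(4) by (auto elim: eventually_mono)
    ultimately show "\<exists>B. ?Q B \<and> (B \<subseteq> A \<and> \<not> (AE x in M. x \<notin> A - B))"
      by blast
  qed
  then obtain A where A: "\<And>n. periodic_set M T (A n)" "\<And>n. A (Suc n) \<subseteq> A n"
    "\<And>n. \<not> (AE x in M. x \<notin> A n - A (Suc n))"
    by blast
  define D where "D n = A n - A (Suc n)" for n
  have D: "periodic_set M T (D n)" for n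
    unfolding D_def using ns A(1) A(1) by (rule periodic_set_Diff)
  then have Ds: "D n \<in> sets M" for n
    by (simp add: periodic_set_iff_AE[OF ns])
  show False
  proof (rule sensitive_no_recurrent_sequence[OF leb ns sens, where A = D and P = D])
    have anti: "A n \<subseteq> A m" if "m \<le> n" for m n
      using A(2) that by (rule lift_Suc_antimono_le)
    have "D m \<inter> D n = {}" if "m < n" for m n
      using anti[of "Suc m" n] that by (auto simp: D_def)
    then show "disjoint_family D"
      unfolding disjoint_family_on_def by (metis Int_commute nat_neq_iff)
    show "0 < emeasure M (D j)" for j
      using A(3)[of j] emeasure_pos_iff_AE[OF Ds[of j]] by (simp add: D_def)
    show "\<exists>n\<ge>n\<^sub>0. AE x in M. x \<in> D j \<longrightarrow> (T ^^ n) x \<in> D j" for j n\<^sub>0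
    proof -
      obtain m where m: "m > 0" "AE x in M. (T ^^ m) x \<in> D j \<longleftrightarrow> x \<in> D j"
        using D[of j] unfolding periodic_set_iff_AE[OF ns] by blast
      have "AE x in M. (T ^^ (m * n\<^sub>0)) x \<in> D j \<longleftrightarrow> x \<in> D j"
        by (rule invariant_imp_AE_mult[OF ns Ds m(2)])
      then have "AE x in M. x \<in> D j \<longrightarrow> (T ^^ (m * n\<^sub>0)) x \<in> D j"
        by eventually_elim simp
      moreover have "n\<^sub>0 \<le> m * n\<^sub>0" using m(1) by simp
      ultimately show ?thesis by blast
    qed
  qed (use Ds in auto)
qed

text \<open>Allows an atom to be exchanged for a forward-invariant representative.\<close>

lemma periodic_atom_cong:
  assumes ns: "nonsingular M T" and atom: "periodic_atom M T A" and A': "A' \<in> sets M"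
    and AA': "AE x in M. x \<in> A' \<longleftrightarrow> x \<in> A"
  shows "periodic_atom M T A'"
proof -
  obtain m where m: "m > 0" "AE x in M. (T ^^ m) x \<in> A \<longleftrightarrow> x \<in> A"
    using atom unfolding periodic_atom_def periodic_set_iff_AE[OF ns] by blast
  have "AE x in M. (T ^^ m) x \<in> A' \<longleftrightarrow> x \<in> A'"
    using m(2) AA' AE_compose_funpow[OF ns AA', of m] by eventually_elim auto
  then have "periodic_set M T A'"
    using m(1) A' unfolding periodic_set_iff_AE[OF ns] by blast
  moreover have "(AE x in M. x \<notin> A') \<longleftrightarrow> (AE x in M. x \<notin> A)"
    by (rule eventually_cong[OF AA']) simp
  moreover have "(AE x in M. x \<in> B \<longrightarrow> x \<in> A') \<longleftrightarrow> (AE x in M. x \<in> B \<longrightarrow> x \<in> A)" for B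
    by (rule eventually_cong[OF AA']) simp
  moreover have "(AE x in M. x \<in> A' \<longrightarrow> x \<in> B) \<longleftrightarrow> (AE x in M. x \<in> A \<longrightarrow> x \<in> B)" for B
    by (rule eventually_cong[OF AA']) simp
  ultimately show ?thesis
    using atom unfolding periodic_atom_def by simp
qed

text \<open>Although \<open>T\<close> need not be invertible, \<open>m - i\<close> further steps
  undo \<open>T ^^ i\<close> on sets with period \<open>m\<close>. A periodic \<open>B\<close> below
  the preimage of \<open>A\<close> is pulled back to a periodic set below \<open>A\<close>, where
  the atom property decides; \<open>i\<close> more steps carry the decision back to
  \<open>B\<close>.\<close>

lemma periodic_atom_vimage:
  assumes ns: "nonsingular M T" and atom: "periodic_atom M T A"
  shows "periodic_atom M T {x \<in> space M. (T ^^ i) x \<in> A}"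
  unfolding periodic_atom_def
proof (intro conjI allI impI)
  let ?V = "{x \<in> space M. (T ^^ i) x \<in> A}"
  have per: "periodic_set M T A" and ne: "\<not> (AE x in M. x \<notin> A)"
    using atom by (auto simp: periodic_atom_def)
  have A: "A \<in> sets M"
    using per by (simp add: periodic_set_iff_AE[OF ns])
  show "periodic_set M T ?V"
    using ns per by (rule periodic_set_vimage)
  show "\<not> (AE x in M. x \<notin> ?V)"
  proof
    assume "AE x in M. x \<notin> ?V"
    then have "AE x in M. (T ^^ i) x \<notin> A"
      using AE_space by eventually_elim auto
    with ne show False
      by (simp add: AE_notin_compose_funpow_iff[OF ns A])
  qed
  fix B assume B: "periodic_set M T B" and BV: "AE x in M. x \<in> B \<longrightarrow> x \<in> ?V"
  have Bs: "B \<in> sets M"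
    using B by (simp add: periodic_set_iff_AE[OF ns])
  obtain m\<^sub>0 where m\<^sub>0: "m\<^sub>0 > 0" "AE x in M. (T ^^ m\<^sub>0) x \<in> A \<longleftrightarrow> x \<in> A"
    "AE x in M. (T ^^ m\<^sub>0) x \<in> B \<longleftrightarrow> x \<in> B"
    using periodic_set_common_period[OF ns per B] .
  \<comment> \<open>A multiple of the common period that is at least \<open>i\<close>, so that
    \<open>m - i\<close> is a true difference; for \<open>i = 0\<close> it is
    \<open>0\<close>.\<close>
  define m where "m = m\<^sub>0 * i"
  have m: "i \<le> m" "AE x in M. (T ^^ m) x \<in> A \<longleftrightarrow> x \<in> A" "AE x in M. (T ^^ m) x \<in> B \<longleftrightarrow> x \<in> B"
    using m\<^sub>0(1) invariant_imp_AE_mult[OF ns A m\<^sub>0(2)] invariant_imp_AE_mult[OF ns Bs m\<^sub>0(3)]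
    by (simp_all add: m_def)
  have Tm: "(T ^^ i) ((T ^^ (m - i)) x) = (T ^^ m) x" "(T ^^ (m - i)) ((T ^^ i) x) = (T ^^ m) x" for x
    using m(1) by (metis comp_apply funpow_add le_add_diff_inverse le_add_diff_inverse2)+
  let ?C = "{x \<in> space M. (T ^^ (m - i)) x \<in> B}"
  have "periodic_set M T ?C"
    using ns B by (rule periodic_set_vimage)
  moreover have "AE x in M. x \<in> ?C \<longrightarrow> x \<in> A"
    using AE_compose_funpow[OF ns BV, of "m - i"] m(2) by eventually_elim (auto simp: Tm)
  ultimately consider "AE x in M. x \<notin> ?C" | "AE x in M. x \<in> A \<longrightarrow> x \<in> ?C"
    using atom unfolding periodic_atom_def by blast
  then show "(AE x in M. x \<notin> B) \<or> (AE x in M. x \<in> ?V \<longrightarrow> x \<in> B)"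
  proof cases
    case 1
    then have "AE x in M. (T ^^ (m - i)) x \<notin> B"
      using AE_space by eventually_elim auto
    then show ?thesis
      by (simp add: AE_notin_compose_funpow_iff[OF ns Bs])
  next
    case 2
    have "AE x in M. x \<in> ?V \<longrightarrow> x \<in> B"
      using AE_compose_funpow[OF ns 2, of i] m(3) by eventually_elim (auto simp: Tm)
    then show ?thesis ..
  qed
qed

text \<open>For \<open>0 < i < n\<close> the atom property says that the preimage of
  \<open>A\<close> under \<open>T ^^ i\<close> either misses \<open>A\<close> or contains it. In the
  second case \<open>i\<close> would already be a period: a point that is in \<open>A\<close> after
  \<open>i\<close> steps is still there after \<open>n * i\<close> steps, and as
  \<open>n * i\<close> is a multiple of \<open>n\<close>, it started in \<open>A\<close>.\<close>

lemma periodic_atom_minimal_period: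
  assumes ns: "nonsingular M T" and atom: "periodic_atom M T A"
  obtains n where "n > 0" "AE x in M. (T ^^ n) x \<in> A \<longleftrightarrow> x \<in> A"
    "\<forall>i. 0 < i \<longrightarrow> i < n \<longrightarrow> (AE x in M. x \<in> A \<longrightarrow> (T ^^ i) x \<notin> A)"
proof -
  have per: "periodic_set M T A"
    using atom by (simp add: periodic_atom_def)
  then have A: "A \<in> sets M"
    by (simp add: periodic_set_iff_AE[OF ns])
  let ?Q = "\<lambda>n. n > 0 \<and> (AE x in M. (T ^^ n) x \<in> A \<longleftrightarrow> x \<in> A)"
  define n where "n = (LEAST n. ?Q n)"
  have "\<exists>n. ?Q n"
    using per unfolding periodic_set_iff_AE[OF ns] by blast
  then have "?Q n"
    unfolding n_def by (rule LeastI_ex)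
  then have n: "n > 0" "AE x in M. (T ^^ n) x \<in> A \<longleftrightarrow> x \<in> A"
    by simp_all
  have "AE x in M. x \<in> A \<longrightarrow> (T ^^ i) x \<notin> A" if i: "0 < i" "i < n" for i
  proof -
    let ?B = "A \<inter> {x \<in> space M. (T ^^ i) x \<in> A}"
    have "periodic_set M T ?B"
      using ns per by (intro periodic_set_Int periodic_set_vimage)
    then consider "AE x in M. x \<notin> ?B" | "AE x in M. x \<in> A \<longrightarrow> x \<in> ?B"
      using atom unfolding periodic_atom_def by fastforce
    then show ?thesis
    proof cases
      case 1
      then show ?thesis using AE_space by eventually_elim auto
    next
      case 2
      then have fwd: "AE x in M. x \<in> A \<longrightarrow> (T ^^ i) x \<in> A"
        by eventually_elim auto
      have iter: "AE x in M. x \<in> A \<longrightarrow> (T ^^ (i * k)) x \<in> A" for k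
      proof (induction k)
        case (Suc k)
        then show ?case
          using AE_compose_funpow[OF ns fwd, of "i * k"] by eventually_elim (auto simp: funpow_add)
      qed simp
      have eq: "(T ^^ (i * (n - 1))) ((T ^^ i) x) = (T ^^ (n * i)) x" for x
      proof -
        have "i * (n - 1) + i = n * i"
          using n(1) by (cases n) auto
        then show ?thesis
          by (metis comp_apply funpow_add)
      qed
      have "AE x in M. (T ^^ i) x \<in> A \<longleftrightarrow> x \<in> A"
        using fwd AE_compose_funpow[OF ns iter[of "n - 1"], of i] invariant_imp_AE_mult[OF ns A n(2), of i]
        by eventually_elim (metis eq)
      then have "n \<le> i"
        unfolding n_def using i(1) by (intro Least_le) simp
      with i(2) show ?thesis by simp
    qed
  qed
  with n show ?thesis using that by blast
qed

text \<open>Weak mixing on a restricted space requires a set that is really mapped into itself. The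
  points whose whole forward orbit stays in \<open>A\<close> form one, and only countably many null
  sets are lost.\<close>

lemma invariant_set_forward_invariant_representative:
  assumes ns: "nonsingular M S" and A: "A \<in> sets M" "AE x in M. S x \<in> A \<longleftrightarrow> x \<in> A"
  obtains A' where "A' \<in> sets M" "AE x in M. x \<in> A' \<longleftrightarrow> x \<in> A" "S ` A' \<subseteq> A'"
proof
  let ?A' = "{x \<in> space M. \<forall>k. (S ^^ k) x \<in> A}"
  show "?A' \<in> sets M"
    using sets_vimage_funpow[OF ns A(1)] by (rule sets.sets_Collect_countable_All)
  have "AE x in M. (S ^^ k) x \<in> A \<longleftrightarrow> x \<in> A" for k
    using invariant_imp_AE_mult[OF ns A(1), of 1 k] A(2) by simp
  then have "AE x in M. \<forall>k. (S ^^ k) x \<in> A \<longleftrightarrow> x \<in> A"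
    by (simp add: AE_all_countable)
  then show "AE x in M. x \<in> ?A' \<longleftrightarrow> x \<in> A"
    using AE_space by eventually_elim (auto dest: spec[of _ 0])
  show "S ` ?A' \<subseteq> ?A'"
  proof safe
    fix x k assume x: "x \<in> space M" "\<forall>k. (S ^^ k) x \<in> A"
    show "S x \<in> space M" using x(1) measurable_space[OF nonsingular_measurable[OF ns]] by blast
    show "(S ^^ k) (S x) \<in> A"
      using x(2)[rule_format, of "Suc k"] by (simp add: funpow_swap1)
  qed
qed
subsection \<open>Eigenvalues on atoms\<close>

lemma eigenfunction_funpow:
  fixes c :: complex
  assumes ns: "nonsingular R S" and eig: "AE x in R. f (S x) = c * f x"
  shows "AE x in R. f ((S ^^ k) x) = c ^ k * f x"
proof (induction k)
  case (Suc k)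
  then show ?case
    using AE_compose_funpow[OF ns eig, of k] by eventually_elim (simp add: ac_simps)
qed simp

text \<open>The measure need not be invariant, so only null sets are compared. If
  \<open>cmod c > 1\<close>, then \<open>f\<close> outgrows its bound along orbits. If
  \<open>cmod c < 1\<close>, then \<open>f\<close> composed with \<open>S ^^ k\<close> is at most
  \<open>cmod c ^ k * C\<close>; nonsingularity transfers this bound to \<open>f\<close> itself,
  which would have to vanish.\<close>

lemma eigenvalue_cmod_1:
  fixes c :: complex
  assumes ns: "nonsingular R S" and f[measurable]: "f \<in> borel_measurable R"
    and bound: "AE x in R. cmod (f x) \<le> C" and nz: "AE x in R. f x \<noteq> 0"
    and eig: "AE x in R. f (S x) = c * f x" and ne: "\<not> (AE x in R. False)"
  shows "cmod c = 1"
proof (rule ccontr)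
  assume "cmod c \<noteq> 1"
  then consider "cmod c > 1" | "cmod c < 1" by linarith
  then have "AE x in R. False"
  proof cases
    case 1
    have "AE x in R. cmod c ^ k * cmod (f x) \<le> C" for k
      using eigenfunction_funpow[OF ns eig, of k] AE_compose_funpow[OF ns bound, of k]
      by eventually_elim (simp add: norm_mult norm_power)
    then have "AE x in R. \<forall>k. cmod c ^ k * cmod (f x) \<le> C"
      by (simp add: AE_all_countable)
    then show ?thesis
      using nz
    proof eventually_elim
      case (elim x)
      obtain k where "C / cmod (f x) < cmod c ^ k"
        using real_arch_pow[OF 1] by blast
      then have "C < cmod c ^ k * cmod (f x)"
        using elim(2) by (simp add: divide_simps)
      then show False
        using elim(1) by (meson not_le)
    qed
  next
    case 2
    have "AE x in R. cmod (f x) \<le> cmod c ^ k * C" for k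
    proof -
      have "AE x in R. cmod (f ((S ^^ k) x)) \<le> cmod c ^ k * C"
        using eigenfunction_funpow[OF ns eig, of k] bound
        by eventually_elim (simp add: norm_mult norm_power mult_left_mono)
      moreover have "{x \<in> space R. cmod (f x) \<le> cmod c ^ k * C} \<in> sets R"
        by measurable
      ultimately show ?thesis
        by (simp add: nonsingular_AE_compose_iff[OF nonsingular_funpow[OF ns],
              of "\<lambda>x. cmod (f x) \<le> cmod c ^ k * C"])
    qed
    then have "AE x in R. \<forall>k. cmod (f x) \<le> cmod c ^ k * C"
      by (simp add: AE_all_countable)
    then show ?thesis
      using nz
    proof eventually_elim
      case (elim x)
      have "cmod (f x) > 0" using elim(2) by simp
      moreover have "cmod (f x) \<le> C" using elim(1)[rule_format, of 0] by simp
      ultimately have "C > 0" by linarith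
      then have C: "C > 0" "cmod (f x) / C > 0" using elim(2) by auto
      obtain k where "cmod c ^ k < cmod (f x) / C"
        using real_arch_pow_inv[OF C(2) 2] by blast
      then have "cmod c ^ k * C < cmod (f x)"
        using C(1) by (simp add: pos_less_divide_eq)
      then show False
        using elim(1) by (meson not_le)
    qed
  qed
  with ne show False ..
qed

text \<open>By Lindelof's theorem the union of all open sets avoided almost everywhere is itself
  avoided almost everywhere. So almost every value of \<open>f\<close> is an essential value, and
  almost every value is nonzero.\<close>

lemma ex_nonzero_essential_value:
  fixes f :: "'a \<Rightarrow> complex"
  assumes nz: "AE x in R. f x \<noteq> 0" and ne: "\<not> (AE x in R. False)"
  obtains z where "z \<noteq> 0" "\<forall>U. open U \<longrightarrow> z \<in> U \<longrightarrow> \<not> (AE x in R. f x \<notin> U)"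
proof -
  let ?F = "{U. open U \<and> (AE x in R. f x \<notin> U)}"
  obtain F' where F': "F' \<subseteq> ?F" "countable F'" "\<Union>F' = \<Union>?F"
    using Lindelof[of ?F] by auto
  have "AE x in R. \<forall>U\<in>F'. f x \<notin> U"
    using F'(1,2) by (subst AE_ball_countable) auto
  then have null: "AE x in R. f x \<notin> \<Union>?F"
    unfolding F'(3)[symmetric] by simp
  have "\<exists>z. z \<noteq> 0 \<and> z \<notin> \<Union>?F"
  proof (rule ccontr)
    assume *: "\<not> ?thesis"
    from null nz have "AE x in R. False"
      by eventually_elim (use * in blast)
    with ne show False ..
  qed
  then show ?thesis using that by blast
qed

text \<open>Compactness of the circle makes two powers of \<open>c\<close> close to each other, and
  their quotient is a power close to \<open>1\<close>. Roots of unity need no separate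
  treatment.\<close>

lemma unit_complex_recurrence:
  fixes c :: complex
  assumes c: "cmod c = 1" and e: "e > 0"
  shows "\<exists>n\<ge>N. cmod (c ^ n - 1) < e"
proof -
  have "\<forall>n. c ^ n \<in> sphere 0 1"
    using c by (simp add: norm_power)
  moreover have "seq_compact (sphere (0::complex) 1)"
    by (simp add: compact_imp_seq_compact)
  ultimately obtain l r where "strict_mono r" "((\<lambda>n. c ^ n) \<circ> r) \<longlonglongrightarrow> l"
    unfolding seq_compact_def by metis
  then have r: "strict_mono r" "Cauchy (\<lambda>n. c ^ r n)"
    by (auto simp: o_def intro: LIMSEQ_imp_Cauchy)
  then obtain m where m: "\<And>i j. i \<ge> m \<Longrightarrow> j \<ge> m \<Longrightarrow> dist (c ^ r i) (c ^ r j) < e"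
    using e unfolding Cauchy_def by blast
  \<comment> \<open>Indices that are \<open>N\<close> places apart in a strictly increasing sequence
    differ by at least \<open>N\<close>, so the exponent is as large as required.\<close>
  define n where "n = r (m + N) - r m"
  have "r m + N \<le> r (m + N)"
    using r(1) by (induction N) (auto simp: strict_mono_Suc_iff intro: less_le_trans Suc_leI le_less_trans)
  then have n: "n \<ge> N" "r (m + N) = n + r m"
    by (auto simp: n_def)
  have "c ^ r (m + N) - c ^ r m = (c ^ n - 1) * c ^ r m"
    unfolding n(2) by (simp add: power_add algebra_simps)
  then have "cmod (c ^ n - 1) = dist (c ^ r (m + N)) (c ^ r m)"
    using c by (simp add: dist_norm norm_mult norm_power)
  also have "\<dots> < e"
    using m by simp
  finally show ?thesis
    using n(1) by blast
qed

text \<open>For an eigenvalue of infinite order, discs around the points \<open>z c\<^sup>n\<close> with \<open>c\<^sup>n\<close> close to \<open>1\<close>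
  yield a recurrent sequence of sets; for one of finite order, the level sets are periodic.\<close>

lemma sensitive_atom_eigenvalue_eq_1:
  fixes M :: "'a measure"
  assumes leb: "lebesgue_space M" and ns: "nonsingular M T" and sens: "measurably_sensitive M T"
    and atom: "periodic_atom M T E" and n: "n > 0"
    and inv: "AE x in M. (T ^^ n) x \<in> E \<longleftrightarrow> x \<in> E"
    and nsR: "nonsingular (restrict_space M E) (T ^^ n)"
    and eigenvalue: "Linf_eigenvalue (restrict_space M E) (T ^^ n) c"
  shows "c = 1"
proof (rule ccontr)
  assume c1: "c \<noteq> 1"
  define R where "R = restrict_space M E"
  define S where "S = T ^^ n"
  have nsR: "nonsingular R S"
    using nsR by (simp add: R_def S_def)
  have E: "E \<in> sets M" and E_pos: "\<not> (AE x in M. x \<notin> E)"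
    using atom by (auto simp: periodic_atom_def periodic_set_iff_AE[OF ns])
  have AER: "(AE x in R. P x) \<longleftrightarrow> (AE x in M. x \<in> E \<longrightarrow> P x)" for P
    unfolding R_def using E by (intro AE_restrict_space_iff) simp
  have ne: "\<not> (AE x in R. False)"
    using E_pos by (simp add: AER)
  have spR: "space R = E"
    using E by (simp add: R_def)
  obtain f :: "'a \<Rightarrow> complex" and C where f: "f \<in> borel_measurable R"
    and bound: "AE x in R. cmod (f x) \<le> C" and nz: "AE x in R. f x \<noteq> 0"
    and eig: "AE x in R. f (S x) = c * f x"
    using eigenvalue unfolding Linf_eigenvalue_def R_def S_def by blast
  have c: "cmod c = 1"
    using eigenvalue_cmod_1[OF nsR f bound nz eig ne] .
  note eig_funpow = eigenfunction_funpow[OF nsR eig]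
  obtain z where z: "z \<noteq> 0" "\<forall>U. open U \<longrightarrow> z \<in> U \<longrightarrow> \<not> (AE x in R. f x \<notin> U)"
    using ex_nonzero_essential_value[OF nz ne] .
  define V where "V U = {x \<in> E. f x \<in> U}" for U
  have V: "V U \<in> sets M" if "open U" for U
  proof -
    have "f -` U \<inter> space R \<in> sets R"
      using f that by (intro measurable_sets[OF f]) auto
    moreover have "f -` U \<inter> space R = V U"
      by (auto simp: spR V_def)
    ultimately show ?thesis
      using E by (simp add: R_def sets_restrict_space_iff)
  qed
  have AE_V: "(AE x in M. x \<notin> V U) \<longleftrightarrow> (AE x in R. f x \<notin> U)" for U
    unfolding AER by (intro AE_cong) (auto simp: V_def)
  have S_mult: "(S ^^ k) x = (T ^^ (n * k)) x" for k x
    by (simp add: S_def funpow_mult)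
  have inv_S: "AE x in M. (S ^^ k) x \<in> E \<longleftrightarrow> x \<in> E" for k
    using invariant_imp_AE_mult[OF ns E inv, of k] by (simp add: S_mult)
  show False
  proof (cases "\<exists>m>0. c ^ m = 1")
    case True
    then obtain m where m: "m > 0" "c ^ m = 1" by blast
    \<comment> \<open>Half the distance from \<open>z\<close> to \<open>c * z\<close>: the disc
      around \<open>z\<close> and its rotation by \<open>c\<close> are disjoint, so \<open>f\<close>
      cannot have values in the disc at both \<open>x\<close> and \<open>S x\<close>.\<close>
    define r where "r = cmod (c * z - z) / 2"
    have "c * z - z \<noteq> 0"
      using c1 z(1) by simp
    then have r: "r > 0"
      by (simp add: r_def)
    let ?B = "V (ball z r)"
    have "AE x in M. (S ^^ m) x \<in> ?B \<longleftrightarrow> x \<in> ?B"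
      using inv_S[of m] eig_funpow[of m, unfolded AER] by eventually_elim (auto simp: V_def m(2))
    then have "periodic_set M T ?B"
      unfolding periodic_set_iff_AE[OF ns] S_mult using V[of "ball z r"] m(1) n
      by (intro conjI exI[of _ "n * m"]) auto
    moreover have "AE x in M. x \<in> ?B \<longrightarrow> x \<in> E"
      by (simp add: V_def)
    moreover have "\<not> (AE x in M. x \<notin> ?B)"
      unfolding AE_V using z(2)[rule_format, of "ball z r"] r by simp
    ultimately have "AE x in M. x \<in> E \<longrightarrow> x \<in> ?B"
      using atom unfolding periodic_atom_def by blast
    then have near: "AE x in R. f x \<in> ball z r"
      unfolding AER by eventually_elim (simp add: V_def)
    have "AE x in R. False"
      using near nonsingular_AE_compose[OF nsR near] eig
    proof eventually_elim
      case (elim x)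
      have "cmod (c * z - z) \<le> cmod (c * z - c * f x) + cmod (c * f x - z)"
        using norm_triangle_ineq[of "c * z - c * f x" "c * f x - z"] by simp
      also have "cmod (c * z - c * f x) = cmod (z - f x)"
        using c by (simp add: norm_mult flip: right_diff_distrib)
      finally show False
        using elim by (simp add: dist_norm r_def norm_minus_commute)
    qed
    with ne show False ..
  next
    case False
    define a where "a m = cmod (c ^ m - 1)" for m
    have a_pos: "a m > 0" if "m > 0" for m
    proof -
      have "c ^ m \<noteq> 1"
        using False that by blast
      then show ?thesis
        by (simp add: a_def)
    qed
    have a_le: "a m \<le> 2" for m
      using norm_triangle_ineq4[of "c ^ m" 1] c by (simp add: a_def norm_power)
    have "\<exists>N. \<forall>k. N k > 0 \<and> a (N (Suc k)) < a (N k) / 3"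
    proof (rule dependent_nat_choice)
      show "\<exists>m::nat. m > 0" by blast
      show "\<exists>m'. m' > 0 \<and> a m' < a m / 3" if "m > 0" for m k :: nat
        using unit_complex_recurrence[OF c, of "a m / 3" 1] a_pos[OF that]
        by (auto simp: a_def Suc_le_eq)
    qed
    then obtain N where N: "\<And>k. N k > 0" "\<And>k. a (N (Suc k)) < a (N k) / 3"
      by blast
    define b where "b k = a (N k)" for k
    have b: "b k > 0" "b k \<le> 2" "b (Suc k) < b k / 3" for k
      using N a_pos a_le by (auto simp: b_def)
    have b_anti: "b l < b k / 3" if "k < l" for k l
      using that
    proof (induction l)
      case (Suc l)
      show ?case
      proof (cases "k = l")
        case False
        then have "b l < b k / 3" using Suc by simp
        then show ?thesis using b(3)[of l] b(1)[of l] by linarith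
      qed (use b in simp)
    qed simp
    define w where "w k = z * c ^ N k" for k
    \<comment> \<open>The centre \<open>w k\<close> has distance \<open>cmod z * b k\<close> from
      \<open>z\<close>. If the discs for \<open>k < l\<close> met, \<open>b l < b k / 3\<close>
      would bound this distance by \<open>(1/3 + 1/9 + 1/3) * cmod z * b k\<close>, which is too
      small.\<close>
    define A where "A k = V (ball (w k) (cmod z * b k / 3))" for k
    \<comment> \<open>Half the radius of the disc for \<open>A k\<close>; the margin
      \<open>cmod z * b k / 6\<close> absorbs the motion under a power of \<open>c\<close> close to
      \<open>1\<close>.\<close>
    define P where "P k = V (ball (w k) (cmod z * b k / 6))" for k
    have zb: "cmod z * b k > 0" for k
      using z(1) b(1) by simp
    have w: "cmod (w k - z) = cmod z * b k" for k
      unfolding w_def b_def a_def norm_mult[symmetric] by (simp add: algebra_simps)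
    \<comment> \<open>Composition with \<open>S ^^ N k\<close> multiplies \<open>f\<close> by
      \<open>c ^ N k\<close>, which rotates discs around \<open>z\<close> onto discs around
      \<open>w k\<close>. By nonsingularity \<open>w k\<close> is an essential value because
      \<open>z\<close> is.\<close>
    have essential: "\<not> (AE x in R. f x \<notin> ball (w k) \<rho>)" if "\<rho> > 0" for k \<rho>
    proof
      assume "AE x in R. f x \<notin> ball (w k) \<rho>"
      from AE_compose_funpow[OF nsR this, of "N k"] eig_funpow[of "N k"]
      have "AE x in R. f x \<notin> ball z \<rho>"
      proof eventually_elim
        case (elim x)
        have "dist (w k) (c ^ N k * f x) = dist z (f x)"
          using c by (simp add: w_def dist_norm norm_mult norm_power mult.commute[of _ "f x"] flip: left_diff_distrib)
        then show ?case using elim by simp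
      qed
      with z(2)[rule_format, of "ball z \<rho>"] that show False by simp
    qed
    show False
    proof (rule sensitive_no_recurrent_sequence[OF leb ns sens, where A = A and P = P])
      show "A j \<in> sets M" "P j \<in> sets M" for j
        by (simp_all add: A_def P_def V)
      show "P j \<subseteq> A j" for j
        using zb[of j] by (auto simp: P_def A_def V_def)
      show "0 < emeasure M (P j)" for j
        using essential[of "cmod z * b j / 6" j] zb[of j]
        unfolding P_def by (subst emeasure_pos_iff_AE) (auto simp: V AE_V)
      have "A k \<inter> A l = {}" if "k < l" for k l
      proof -
        have bl: "cmod z * b l \<le> cmod z * (b k / 3)"
          using b_anti[OF that] by (intro mult_left_mono) auto
        have False
          if v: "dist (w k) v < cmod z * b k / 3" "dist (w l) v < cmod z * b l / 3" for v
        proof -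
          have "cmod (w k - z) \<le> cmod (w k - v) + cmod (w l - v) + cmod (w l - z)"
            using norm_triangle_ineq4[of "w k - v" "w l - v"] norm_triangle_ineq[of "w k - w l" "w l - z"]
            by simp
          then show False
            using v bl zb[of k] unfolding w dist_norm by simp
        qed
        then show ?thesis
          by (auto simp: A_def V_def)
      qed
      then show "disjoint_family A"
        unfolding disjoint_family_on_def by (metis Int_commute nat_neq_iff)
      show "\<exists>m\<ge>m\<^sub>0. AE x in M. x \<in> P j \<longrightarrow> (T ^^ m) x \<in> A j" for j m\<^sub>0
      proof -
        \<comment> \<open>On \<open>P j\<close> the bound \<open>b j \<le> 2\<close> gives
          \<open>cmod (f x) \<le> cmod z * 3\<close>, so with \<open>18 = 3 * 6\<close> the value
          \<open>f x\<close> moves by at most the margin \<open>cmod z * b j / 6\<close>.\<close>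
        obtain m where m: "m \<ge> m\<^sub>0" "cmod (c ^ m - 1) < b j / 18"
          using unit_complex_recurrence[OF c, of "b j / 18" m\<^sub>0] b(1)[of j] by auto
        have "AE x in M. x \<in> P j \<longrightarrow> (S ^^ m) x \<in> A j"
          using inv_S[of m] eig_funpow[of m, unfolded AER]
        proof eventually_elim
          case (elim x)
          show ?case
          proof
            assume "x \<in> P j"
            then have x: "x \<in> E" "cmod (w j - f x) < cmod z * b j / 6"
              by (auto simp: P_def V_def dist_norm)
            have "cmod (f x) \<le> cmod (w j) + cmod (w j - f x)"
              using norm_triangle_ineq4[of "w j" "w j - f x"] by simp
            also have "cmod (w j) = cmod z"
              using c by (simp add: w_def norm_mult norm_power)
            also have "cmod (w j - f x) \<le> cmod z * (b j / 6)"
              using x(2) by simp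
            also have "\<dots> \<le> cmod z * 2"
              using b(2)[of j] by (intro mult_left_mono) auto
            finally have fx: "cmod (f x) \<le> cmod z * 3"
              by simp
            have "cmod (f x - c ^ m * f x) = cmod (c ^ m - 1) * cmod (f x)"
              by (simp add: norm_mult[symmetric] algebra_simps norm_minus_commute)
            also have "\<dots> \<le> b j / 18 * (cmod z * 3)"
              using m(2) fx b(1)[of j] by (intro mult_mono) auto
            finally have "cmod (f x - c ^ m * f x) \<le> cmod z * b j / 6"
              by simp
            then have "cmod (w j - c ^ m * f x) < cmod z * b j / 3"
              using x(2) norm_triangle_ineq[of "w j - f x" "f x - c ^ m * f x"] by simp
            then show "(S ^^ m) x \<in> A j"
              using elim x(1) by (simp add: A_def V_def dist_norm)
          qed
        qed
        then show ?thesis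
          unfolding S_mult using m(1) n by (intro exI[of _ "n * m"]) (auto intro: order_trans)
      qed
    qed
  qed
qed

section \<open>Weak mixing on atoms and the translates of one atom\<close>

lemma nonsingular_restrict_space:
  assumes ns: "nonsingular M S" and E: "E \<in> sets M"
    and inv: "AE x in M. S x \<in> E \<longleftrightarrow> x \<in> E" and SE: "S ` E \<subseteq> E"
  shows "nonsingular (restrict_space M E) S"
proof -
  have S: "S \<in> M \<rightarrow>\<^sub>M M"
    using ns by (rule nonsingular_measurable)
  have "emeasure (restrict_space M E) (S -` B \<inter> space (restrict_space M E)) = 0 \<longleftrightarrow>
      emeasure (restrict_space M E) B = 0" if "B \<in> sets (restrict_space M E)" for B
  proof -
    have B: "B \<in> sets M" "B \<subseteq> E"
      using that E by (auto simp: sets_restrict_space_iff)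
    have "emeasure M (S -` B \<inter> E) = emeasure M (S -` B \<inter> space M)"
    proof (rule emeasure_eq_AE)
      show "AE x in M. x \<in> S -` B \<inter> E \<longleftrightarrow> x \<in> S -` B \<inter> space M"
        using inv AE_space by eventually_elim (use B(2) in auto)
      show "S -` B \<inter> space M \<in> sets M"
        by (rule measurable_sets[OF S B(1)])
      then have "(S -` B \<inter> space M) \<inter> E \<in> sets M"
        using E by (rule sets.Int)
      also have "(S -` B \<inter> space M) \<inter> E = S -` B \<inter> E"
        using sets.sets_into_space[OF E] by auto
      finally show "S -` B \<inter> E \<in> sets M" .
    qed
    then show ?thesis
      using E B nonsingular_emeasure_vimage[OF ns B(1)] by (simp add: emeasure_restrict_space)
  qed
  moreover have "S \<in> restrict_space M E \<rightarrow>\<^sub>M restrict_space M E"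
    using S SE by (intro measurable_restrict_space3) auto
  ultimately show ?thesis
    unfolding nonsingular_def by blast
qed

text \<open>A subset of \<open>E\<close> that is invariant under \<open>T ^^ n\<close> is itself
  periodic, so the atom property leaves it null or co-null in \<open>E\<close>; this is ergodicity
  of the restriction. Constants provide the eigenvalue \<open>1\<close>.\<close>

lemma weakly_mixing_restrict_periodic_atom:
  assumes leb: "lebesgue_space M" and ns: "nonsingular M T" and sens: "measurably_sensitive M T"
    and atom: "periodic_atom M T E" and n: "n > 0"
    and inv: "AE x in M. (T ^^ n) x \<in> E \<longleftrightarrow> x \<in> E" and TE: "(T ^^ n) ` E \<subseteq> E"
  shows "weakly_mixing (restrict_space M E) (T ^^ n)"
proof -
  let ?R = "restrict_space M E"
  have E: "E \<in> sets M"
    using atom by (simp add: periodic_atom_def periodic_set_iff_AE[OF ns])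
  have AER: "(AE x in ?R. P x) \<longleftrightarrow> (AE x in M. x \<in> E \<longrightarrow> P x)" for P
    using E by (intro AE_restrict_space_iff) simp
  have nsR: "nonsingular ?R (T ^^ n)"
    using nonsingular_funpow[OF ns] E inv TE by (rule nonsingular_restrict_space)
  have "ergodic ?R (T ^^ n)"
    unfolding ergodic_def
  proof (intro allI impI)
    fix B assume "invariant_set ?R (T ^^ n) B"
    then have B: "B \<in> sets M" "B \<subseteq> E" and invB: "AE x in M. x \<in> E \<longrightarrow> ((T ^^ n) x \<in> B \<longleftrightarrow> x \<in> B)"
      using E unfolding invariant_set_iff_AE[OF nonsingular_measurable[OF nsR]] AER
      by (auto simp: sets_restrict_space_iff)
    from inv invB have "AE x in M. (T ^^ n) x \<in> B \<longleftrightarrow> x \<in> B"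
      by eventually_elim (use B(2) in blast)
    then have "periodic_set M T B"
      using B(1) n unfolding periodic_set_iff_AE[OF ns] by blast
    then consider "AE x in M. x \<notin> B" | "AE x in M. x \<in> E \<longrightarrow> x \<in> B"
      using atom B(2) unfolding periodic_atom_def by (metis (mono_tags, lifting) AE_I2 subsetD)
    then show "emeasure ?R B = 0 \<or> emeasure ?R (space ?R - B) = 0"
    proof cases
      case 1
      then have "emeasure M B = 0"
        using AE_iff_null_sets[OF B(1)] by auto
      then show ?thesis
        using E B by (simp add: emeasure_restrict_space)
    next
      case 2
      then have "AE x in M. x \<notin> E - B"
        by eventually_elim auto
      then have "emeasure M (E - B) = 0"
        using AE_iff_null_sets[of "E - B" M] E B(1) by auto
      then show ?thesis
        using E B by (simp add: emeasure_restrict_space)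
    qed
  qed
  moreover have "Linf_eigenvalue ?R (T ^^ n) 1"
    unfolding Linf_eigenvalue_def by (intro exI[of _ "\<lambda>_. 1"]) auto
  moreover have "c = 1" if "Linf_eigenvalue ?R (T ^^ n) c" for c
    using sensitive_atom_eigenvalue_eq_1[OF leb ns sens atom n inv nsR that] .
  ultimately show ?thesis
    using nsR unfolding weakly_mixing_def by blast
qed

theorem proposition3p5:
  fixes M :: "'a measure" and T :: "'a \<Rightarrow> 'a"
  assumes "lebesgue_space M" and "non_atomic M" and "0 < emeasure M (space M)"
    and "nonsingular M T" and "ergodic M T" and "measurably_sensitive M T"
  shows "\<exists>n>0. \<exists>A :: nat \<Rightarrow> 'a set.
           (\<forall>i<n. invariant_set M (T ^^ n) (A i) \<and> 0 < emeasure M (A i) \<and>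
                  weakly_mixing (restrict_space M (A i)) (T ^^ n)) \<and>
           (\<forall>i<n. \<forall>j<n. i \<noteq> j \<longrightarrow> \<not> eq_mod_null M (A i) (A j))"
proof -
  note leb = assms(1) and ns = assms(4) and sens = assms(6)
  note meas = nonsingular_measurable[OF nonsingular_funpow[OF ns]]
  obtain B\<^sub>0 where B\<^sub>0: "periodic_atom M T B\<^sub>0"
    using ex_periodic_atom[OF leb ns sens assms(3)] .
  obtain n where n: "n > 0" and B\<^sub>0n: "AE x in M. (T ^^ n) x \<in> B\<^sub>0 \<longleftrightarrow> x \<in> B\<^sub>0"
    and min\<^sub>0: "\<forall>i. 0 < i \<longrightarrow> i < n \<longrightarrow> (AE x in M. x \<in> B\<^sub>0 \<longrightarrow> (T ^^ i) x \<notin> B\<^sub>0)"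
    using periodic_atom_minimal_period[OF ns B\<^sub>0] .
  have B\<^sub>0s: "B\<^sub>0 \<in> sets M"
    using B\<^sub>0 by (simp add: periodic_atom_def periodic_set_iff_AE[OF ns])
  \<comment> \<open>The representative is chosen before preimages are formed, so that all of them
    inherit forward invariance under \<open>T ^^ n\<close>.\<close>
  obtain B where B: "B \<in> sets M" and BB\<^sub>0: "AE x in M. x \<in> B \<longleftrightarrow> x \<in> B\<^sub>0" and TB: "(T ^^ n) ` B \<subseteq> B"
    using invariant_set_forward_invariant_representative[OF nonsingular_funpow[OF ns] B\<^sub>0s B\<^sub>0n] .
  have atomB: "periodic_atom M T B"
    using ns B\<^sub>0 B BB\<^sub>0 by (rule periodic_atom_cong)
  have Bn: "AE x in M. (T ^^ n) x \<in> B \<longleftrightarrow> x \<in> B"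
    using B\<^sub>0n BB\<^sub>0 AE_compose_funpow[OF ns BB\<^sub>0, of n] by eventually_elim simp
  have minB: "AE x in M. x \<in> B \<longrightarrow> (T ^^ i) x \<notin> B" if "0 < i" "i < n" for i
    using min\<^sub>0[rule_format, OF that] BB\<^sub>0 AE_compose_funpow[OF ns BB\<^sub>0, of i]
    by eventually_elim simp
  \<comment> \<open>Preimages instead of images, because they are measurable and remain atoms even
    if \<open>T\<close> is not invertible.\<close>
  define A where "A i = {x \<in> space M. (T ^^ i) x \<in> B}" for i
  have A: "A i \<in> sets M" for i
    unfolding A_def using ns B by (rule sets_vimage_funpow)
  have An: "AE x in M. (T ^^ n) x \<in> A i \<longleftrightarrow> x \<in> A i" for i
    unfolding A_def using ns Bn by (rule AE_vimage_funpow)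
  have atomA: "periodic_atom M T (A i)" for i
    unfolding A_def using ns atomB by (rule periodic_atom_vimage)
  have TA: "(T ^^ n) ` A i \<subseteq> A i" for i
  proof safe
    fix x assume x: "x \<in> A i"
    have "(T ^^ i) ((T ^^ n) x) = (T ^^ n) ((T ^^ i) x)"
      by (metis add.commute comp_apply funpow_add)
    also have "\<dots> \<in> B"
      using x TB by (auto simp: A_def)
    finally show "(T ^^ n) x \<in> A i"
      using x measurable_space[OF meas] by (auto simp: A_def)
  qed
  \<comment> \<open>If two of the sets agreed, almost every point of \<open>A i\<close> would be in
    \<open>B\<close> at time \<open>i\<close> and again \<open>j - i < n\<close> steps later, which
    the least period forbids; \<open>A i\<close> would be null.\<close>
  have distinct: "\<not> eq_mod_null M (A i) (A j)" if "i < j" "j < n" for i j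
  proof
    assume "eq_mod_null M (A i) (A j)"
    then have "AE x in M. x \<in> A i \<longleftrightarrow> x \<in> A j"
      using eq_mod_null_iff_AE[OF A A] by blast
    moreover have "AE x in M. (T ^^ i) x \<in> B \<longrightarrow> (T ^^ (j - i)) ((T ^^ i) x) \<notin> B"
      using that by (intro AE_compose_funpow[OF ns] minB) auto
    ultimately have "AE x in M. x \<notin> A i"
    proof eventually_elim
      case (elim x)
      have "(T ^^ (j - i)) ((T ^^ i) x) = (T ^^ j) x"
        using that(1) by (metis comp_apply funpow_add le_add_diff_inverse2 less_imp_le)
      with elim show ?case
        by (auto simp: A_def)
    qed
    with atomA[of i] show False
      by (simp add: periodic_atom_def)
  qed
  have "invariant_set M (T ^^ n) (A i) \<and> 0 < emeasure M (A i) \<and>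
      weakly_mixing (restrict_space M (A i)) (T ^^ n)" for i
    using A[of i] An[of i] atomA[of i] weakly_mixing_restrict_periodic_atom[OF leb ns sens atomA n An TA]
    by (simp add: invariant_set_iff_AE[OF meas] emeasure_pos_iff_AE periodic_atom_def)
  moreover have "\<not> eq_mod_null M (A i) (A j)" if "i < n" "j < n" "i \<noteq> j" for i j
  proof (cases "i < j")
    case False
    then show ?thesis
      using distinct[of j i] that by (auto simp: eq_mod_null_def Un_commute)
  qed (use distinct that in auto)
  ultimately show ?thesis
    using n by blast
qed

end
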